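(* Let $\nu\ge 2$, let $0$ be a critical point of a smooth function $f:\mathbb R^\nu\to\mathbb R$ in variables $k=(k_1,\dots,k_\nu)$, and suppose that the kernel of the second differential of $f$ at the origin coincides with the coordinate plane $Ok_1k_2$. Put $$A=\frac1{3!}\frac{\partial^3f(0)}{\partial k_1^3},\quad B=\frac1{2!}\frac{\partial^3f(0)}{\partial k_1^2\partial k_2},\quad C=\frac1{2!}\frac{\partial^3f(0)}{\partial k_1\partial k_2^2},\quad D=\frac1{3!}\frac{\partial^3f(0)}{\partial k_2^3},$$ $$\Delta_3=4(B^3D+AC^3)+27A^2D^2-B^2C^2-18ABCD.$$ Then the germ of $f$ at the origin has a singularity of type $D_4$ if and only if $\Delta_3\neq0$. Moreover, if $\Delta_3\ne0$, then in some neighbourhood of the origin $f$ reduces to the form $$f=d+\tilde k_1^2\tilde k_2+\Delta_3\tilde k_2^3+Q(\tilde k_3,\dots,\tilde k_\nu)$$ by a regular smooth change of variables $k\to\tilde k$ leaving $0$ fixed, where $d$ is a constant and $Q$ is a nondegenerate quadratic form in $\nu-2$ variables. In particular, $f\in D_4^+$ if $\Delta_3>0$ and $f\in D_4^-$ if $\Delta_3<0$.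
   Context: A germ $f$ at a critical point $0\in\mathbb R^\nu$ has a singularity of type $D_4^{\pm}$ if there is a germ of diffeomorphism fixing $0$ after which $f=\mathrm{const}+x_1^2x_2\pm x_2^3+Q(x_3,\dots,x_\nu)$ with $Q$ a nondegenerate quadratic form; type $D_4$ means $D_4^+$ or $D_4^-$. *)

theory Defs
  imports "HOL-Analysis.Analysis"
begin

text \<open>C-n and smooth maps; the definitions are only meant to be used on open sets \<open>S\<close>.\<close>

fun Cn_on :: "nat \<Rightarrow> 'a::real_normed_vector set \<Rightarrow> ('a \<Rightarrow> 'b::real_normed_vector) \<Rightarrow> bool" where
  "Cn_on 0 S f \<longleftrightarrow> continuous_on S f"
| "Cn_on (Suc n) S f \<longleftrightarrow>
     (\<forall>x\<in>S. f differentiable (at x)) \<and>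
     (\<forall>v. Cn_on n S (\<lambda>x. frechet_derivative f (at x) v))"

definition smooth_on :: "'a::real_normed_vector set \<Rightarrow> ('a \<Rightarrow> 'b::real_normed_vector) \<Rightarrow> bool" where
  "smooth_on S f \<longleftrightarrow> (\<forall>n. Cn_on n S f)"

definition partial_deriv :: "'n::finite \<Rightarrow> (real^'n \<Rightarrow> real) \<Rightarrow> real^'n \<Rightarrow> real" where
  "partial_deriv i f x = deriv (\<lambda>t. f (x + t *\<^sub>R axis i 1)) 0"

definition critical_point :: "('a::real_normed_vector \<Rightarrow> real) \<Rightarrow> 'a \<Rightarrow> bool" where
  "critical_point f x \<longleftrightarrow> (f has_derivative (\<lambda>v. 0)) (at x)"

definition second_differential ::
    "('a::real_normed_vector \<Rightarrow> real) \<Rightarrow> 'a \<Rightarrow> 'a \<Rightarrow> 'a \<Rightarrow> real" where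
  "second_differential f x u v =
     frechet_derivative (\<lambda>y. frechet_derivative f (at y) u) (at x) v"

definition second_differential_kernel :: "('a::real_normed_vector \<Rightarrow> real) \<Rightarrow> 'a \<Rightarrow> 'a set" where
  "second_differential_kernel f x = {u. \<forall>v. second_differential f x u v = 0}"

text \<open>The coordinates of a point of \<open>real^'n\<close> are not numbered; the first two coordinates are
  represented by two distinct indices \<open>i\<close> and \<open>j\<close>, and the remaining ones by
  \<open>UNIV - {i, j}\<close>. In particular \<open>CARD('n) \<ge> 2\<close>.\<close>

definition coordinate_plane :: "'n::finite \<Rightarrow> 'n \<Rightarrow> (real^'n) set" where
  "coordinate_plane i j = {u. \<forall>l. l \<noteq> i \<and> l \<noteq> j \<longrightarrow> u $ l = 0}"

text \<open>\<open>Q\<close> is a nondegenerate quadratic form in the variables \<open>x $ l\<close>, \<open>l \<in> K\<close>, only;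
  for \<open>K = {}\<close> this means \<open>Q = 0\<close>.\<close>

definition nondegenerate_quadratic_form :: "'n::finite set \<Rightarrow> (real^'n \<Rightarrow> real) \<Rightarrow> bool" where
  "nondegenerate_quadratic_form K Q \<longleftrightarrow>
     (\<exists>q :: 'n \<Rightarrow> 'n \<Rightarrow> real.
        (\<forall>l\<in>K. \<forall>m\<in>K. q l m = q m l) \<and>
        (\<forall>x. Q x = (\<Sum>l\<in>K. \<Sum>m\<in>K. q l m * x $ l * x $ m)) \<and>
        (\<forall>x :: real^'n. (\<forall>l\<in>K. (\<Sum>m\<in>K. q l m * x $ m) = 0) \<longrightarrow> (\<forall>l\<in>K. x $ l = 0)))"

definition local_diffeo_fixing_0 ::
    "'a::real_normed_vector set \<Rightarrow> ('a \<Rightarrow> 'a) \<Rightarrow> bool" where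
  "local_diffeo_fixing_0 U \<phi> \<longleftrightarrow>
     open U \<and> 0 \<in> U \<and> \<phi> 0 = 0 \<and> smooth_on U \<phi> \<and> open (\<phi> ` U) \<and>
     (\<exists>\<psi>. smooth_on (\<phi> ` U) \<psi> \<and> (\<forall>x\<in>U. \<psi> (\<phi> x) = x))"

text \<open>In the new variables \<open>\<phi> k\<close> the function \<open>f\<close> takes the form \<open>g\<close> near the origin.\<close>

definition reduces_near_0 :: "('a::real_normed_vector \<Rightarrow> real) \<Rightarrow> ('a \<Rightarrow> real) \<Rightarrow> bool" where
  "reduces_near_0 f g \<longleftrightarrow>
     (\<exists>U \<phi>. local_diffeo_fixing_0 U \<phi> \<and> (\<forall>k\<in>U. f k = g (\<phi> k)))"

definition D4_plus :: "'n::finite \<Rightarrow> 'n \<Rightarrow> (real^'n \<Rightarrow> real) \<Rightarrow> bool" where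
  "D4_plus i j f \<longleftrightarrow>
     (\<exists>c Q. nondegenerate_quadratic_form (UNIV - {i, j}) Q \<and>
        reduces_near_0 f (\<lambda>x. c + (x $ i)\<^sup>2 * x $ j + (x $ j)^3 + Q x))"

definition D4_minus :: "'n::finite \<Rightarrow> 'n \<Rightarrow> (real^'n \<Rightarrow> real) \<Rightarrow> bool" where
  "D4_minus i j f \<longleftrightarrow>
     (\<exists>c Q. nondegenerate_quadratic_form (UNIV - {i, j}) Q \<and>
        reduces_near_0 f (\<lambda>x. c + (x $ i)\<^sup>2 * x $ j - (x $ j)^3 + Q x))"

definition D4 :: "'n::finite \<Rightarrow> 'n \<Rightarrow> (real^'n \<Rightarrow> real) \<Rightarrow> bool" where
  "D4 i j f \<longleftrightarrow> D4_plus i j f \<or> D4_minus i j f"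

end

theory Submission
  imports Defs
begin

text \<open>
  Write \<open>z = p + r\<close> with \<open>p\<close> in the kernel plane. Hadamard's lemma gives
  \<open>f = f(0) + c(z)(p) + r \<bullet> b(z)(p) + r \<bullet> q(z) r\<close>, where \<open>c(z)\<close> is a binary cubic form, \<open>b(z)\<close> is quadratic
  in \<open>p\<close>, \<open>q(0)\<close> is nondegenerate, and all coefficients are smooth in \<open>z\<close>. Completing the square in \<open>r\<close>
  changes \<open>c(z)\<close> only by a quartic in \<open>p\<close>, that is, by coefficients vanishing at \<open>0\<close>. If \<open>\<Delta> \<noteq> 0\<close>, the linear
  orbit of the cubic \<open>x\<^sup>2 y + \<Delta> y\<^sup>3\<close> is open and contains \<open>c(0)\<close>, so \<open>c(z)\<close> is carried to this normal form by a
  linear substitution depending smoothly on \<open>z\<close>; a matrix square root does the same for \<open>q(z)\<close> and \<open>q(0)\<close>.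
  Conversely, a reduction of \<open>f\<close> to a normal form identifies the cubic forms on the kernel planes up to a linear isomorphism,
  under which \<open>\<Delta>\<close> is multiplied by the sixth power of the determinant.
\<close>

subsection \<open>Calculus of smooth maps\<close>

text \<open>The price is that a substitution which is linear for each fixed \<open>z\<close> is no
  longer a linear map of \<open>z\<close>. It is still a local diffeomorphism, because its
  derivative at 0 is the substitution frozen at \<open>z = 0\<close>: the variation of the
  coefficients is multiplied by quantities that vanish at 0. The orbit of
  \<open>x\<^sup>2 y + e y\<^sup>3\<close> is open near that cubic because substitutions and cubics
  both form spaces of dimension 4, and the derivative of the action at the identity is injective as
  soon as \<open>e \<noteq> 0\<close>. Since a sixth power of a nonzero number is positive, the sign
  of the discriminant is invariant under linear changes, while its size can be rescaled; so
  \<open>e\<close> may be any number of that sign, in particular 1, -1 or the discriminant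
  itself.\<close>

definition dirderiv :: "'a::real_normed_vector \<Rightarrow> ('a \<Rightarrow> 'b::real_normed_vector) \<Rightarrow> 'a \<Rightarrow> 'b"
  where "dirderiv v f = (\<lambda>x. frechet_derivative f (at x) v)"

text \<open>With the direction as first argument, \<open>dirderiv v\<close> is an operator on
  functions: the recursion of \<open>Cn_on\<close> becomes its repeated application, and powers such
  as \<open>dirderiv r ^^ m\<close> make sense.\<close>

lemma Cn_on_Suc:
  "Cn_on (Suc n) S f \<longleftrightarrow> (\<forall>x\<in>S. f differentiable (at x)) \<and> (\<forall>v. Cn_on n S (dirderiv v f))"
  by (simp add: dirderiv_def)

lemmas [simp del] = Cn_on.simps(2)

lemma dirderiv_eqI: "(f has_derivative f') (at x) \<Longrightarrow> dirderiv v f x = f' v"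
  by (metis dirderiv_def frechet_derivative_at)

lemma differentiable_dirderiv:
  "f differentiable (at x) \<Longrightarrow> (f has_derivative (\<lambda>v. dirderiv v f x)) (at x)"
  unfolding dirderiv_def by (simp add: frechet_derivative_works[symmetric])

lemma Cn_on_SucI:
  assumes "\<And>x. x \<in> S \<Longrightarrow> (f has_derivative (\<lambda>v. f' v x)) (at x)" and "\<And>v. Cn_on n S (dirderiv v f)"
  shows "Cn_on (Suc n) S f"
  using assms by (auto simp: Cn_on_Suc differentiable_def)

text \<open>Derivatives are taken in the full space, so values on \<open>S\<close> determine them
  only because \<open>S\<close> is open.\<close>

lemma Cn_on_cong_imp:
  assumes "open S" "Cn_on n S f" "\<And>x. x \<in> S \<Longrightarrow> f x = g x"
  shows "Cn_on n S g"
  using assms(2,3)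
proof (induction n arbitrary: f g)
  case 0
  then show ?case by (simp cong: continuous_on_cong)
next
  case (Suc n)
  have *: "(g has_derivative (\<lambda>v. dirderiv v f x)) (at x)" if "x \<in> S" for x
    by (rule has_derivative_transform_within_open[OF differentiable_dirderiv \<open>open S\<close> that])
      (use Suc.prems that in \<open>auto simp: Cn_on_Suc\<close>)
  show ?case
  proof (rule Cn_on_SucI[OF *])
    fix v
    show "Cn_on n S (dirderiv v g)"
    proof (rule Suc.IH)
      show "Cn_on n S (dirderiv v f)" using Suc.prems by (simp add: Cn_on_Suc)
      show "\<And>x. x \<in> S \<Longrightarrow> dirderiv v f x = dirderiv v g x"
        using dirderiv_eqI[OF *] by simp
    qed
  qed auto
qed

text \<open>The induction step of all closure properties below: differentiate once by an explicit
  formula \<open>f'\<close>, then apply the induction hypothesis to the formula.\<close>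

lemma Cn_on_SucI':
  assumes "open S" "\<And>x. x \<in> S \<Longrightarrow> (f has_derivative (\<lambda>v. f' v x)) (at x)" "\<And>v. Cn_on n S (f' v)"
  shows "Cn_on (Suc n) S f"
proof (rule Cn_on_SucI[OF assms(2)])
  show "Cn_on n S (dirderiv v f)" for v
    by (rule Cn_on_cong_imp[OF assms(1) assms(3)[of v]]) (simp add: dirderiv_eqI[OF assms(2)])
qed auto

lemma Cn_on_SucE:
  assumes "Cn_on (Suc n) S f" and "x \<in> S"
  shows "(f has_derivative (\<lambda>v. dirderiv v f x)) (at x)"
  using assms by (auto simp: Cn_on_Suc intro: differentiable_dirderiv)

lemma Cn_on_SucD: "Cn_on (Suc n) S f \<Longrightarrow> Cn_on n S (dirderiv v f)"
  by (simp add: Cn_on_Suc)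

lemma Cn_on_lower: "Cn_on (Suc n) S f \<Longrightarrow> Cn_on n S f"
proof (induction n arbitrary: f)
  case 0
  then show ?case
    by (auto simp: Cn_on_Suc intro!: continuous_at_imp_continuous_on differentiable_imp_continuous_within)
next
  case (Suc n)
  then show ?case by (metis Cn_on_Suc)
qed

lemma Cn_on_mono: "Cn_on n S f \<Longrightarrow> m \<le> n \<Longrightarrow> Cn_on m S f"
  by (induction n) (auto simp: le_Suc_eq intro: Cn_on_lower)

lemma Cn_on_subset: "Cn_on n S f \<Longrightarrow> T \<subseteq> S \<Longrightarrow> Cn_on n T f"
  by (induction n arbitrary: f) (auto simp: Cn_on_Suc intro: continuous_on_subset)

lemma Cn_on_const: "Cn_on n S (\<lambda>x. c)"
proof (induction n arbitrary: c)
  case (Suc n)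
  have "dirderiv v (\<lambda>x. c) = (\<lambda>x. 0)" for v :: 'a and c :: 'b
    by (simp add: dirderiv_def)
  with Suc show ?case by (auto simp: Cn_on_Suc)
qed auto

lemma Cn_on_bounded_linear:
  assumes "open S" "bounded_linear L" "Cn_on n S f"
  shows "Cn_on n S (\<lambda>x. L (f x))"
  using assms(3)
proof (induction n arbitrary: f)
  case 0
  then show ?case using assms(2) by (simp add: bounded_linear.continuous_on)
next
  case (Suc n)
  show ?case
  proof (rule Cn_on_SucI'[OF assms(1), where f'="\<lambda>v x. L (dirderiv v f x)"])
    show "((\<lambda>x. L (f x)) has_derivative (\<lambda>v. L (dirderiv v f x))) (at x)" if "x \<in> S" for x
      by (rule bounded_linear.has_derivative[OF assms(2) Cn_on_SucE[OF Suc.prems that]])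
    show "Cn_on n S (\<lambda>x. L (dirderiv v f x))" for v
      by (rule Suc.IH[OF Cn_on_SucD[OF Suc.prems]])
  qed
qed

lemma Cn_on_add:
  assumes "open S" "Cn_on n S f" "Cn_on n S g"
  shows "Cn_on n S (\<lambda>x. f x + g x)"
  using assms(2,3)
proof (induction n arbitrary: f g)
  case 0
  then show ?case by (simp add: continuous_on_add)
next
  case (Suc n)
  show ?case
  proof (rule Cn_on_SucI'[OF assms(1), where f'="\<lambda>v x. dirderiv v f x + dirderiv v g x"])
    show "((\<lambda>x. f x + g x) has_derivative (\<lambda>v. dirderiv v f x + dirderiv v g x)) (at x)"
      if "x \<in> S" for x
      by (intro has_derivative_add Cn_on_SucE[OF Suc.prems(1) that] Cn_on_SucE[OF Suc.prems(2) that])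
    show "Cn_on n S (\<lambda>x. dirderiv v f x + dirderiv v g x)" for v
      using Suc by (simp add: Cn_on_Suc)
  qed
qed

lemma Cn_on_sum:
  assumes "open S" "\<And>i. i \<in> I \<Longrightarrow> Cn_on n S (f i)"
  shows "Cn_on n S (\<lambda>x. \<Sum>i\<in>I. f i x)"
  using assms(2)
  by (induction I rule: infinite_finite_induct) (auto simp: Cn_on_const intro: Cn_on_add[OF assms(1)])

text \<open>Stated for an arbitrary bounded bilinear map so that scalar, inner and matrix products
  are all instances.\<close>

lemma Cn_on_bilinear:
  assumes "open S" "bounded_bilinear B" "Cn_on n S f" "Cn_on n S g"
  shows "Cn_on n S (\<lambda>x. B (f x) (g x))"
  using assms(3,4)
proof (induction n arbitrary: f g)
  case 0
  then show ?case using assms(2) by (simp add: bounded_bilinear.continuous_on)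
next
  case (Suc n)
  show ?case
  proof (rule Cn_on_SucI'[OF assms(1),
        where f'="\<lambda>v x. B (f x) (dirderiv v g x) + B (dirderiv v f x) (g x)"])
    show "((\<lambda>x. B (f x) (g x)) has_derivative
        (\<lambda>v. B (f x) (dirderiv v g x) + B (dirderiv v f x) (g x))) (at x)" if "x \<in> S" for x
      by (intro bounded_bilinear.FDERIV[OF assms(2)] Cn_on_SucE[OF Suc.prems(1) that]
          Cn_on_SucE[OF Suc.prems(2) that])
    show "Cn_on n S (\<lambda>x. B (f x) (dirderiv v g x) + B (dirderiv v f x) (g x))" for v
      using Suc by (intro Cn_on_add[OF assms(1)] Suc.IH) (auto simp: Cn_on_SucD Cn_on_lower)
  qed
qed

text \<open>In the chain rule \<open>g\<close> is differentiated in a direction that varies with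
  \<open>x\<close>, whereas \<open>Cn_on\<close> controls fixed directions only. Expanding the
  direction in a basis repairs this, whence the Euclidean space in the middle.\<close>

lemma Cn_on_compose:
  fixes g :: "'b::euclidean_space \<Rightarrow> 'c::real_normed_vector"
  assumes "open S" "open T" "Cn_on n S f" "Cn_on n T g" "f ` S \<subseteq> T"
  shows "Cn_on n S (\<lambda>x. g (f x))"
  using assms(3,4)
proof (induction n arbitrary: g)
  case 0
  then show ?case using assms(5) by (auto intro: continuous_on_compose2)
next
  case (Suc n)
  have fT: "f x \<in> T" if "x \<in> S" for x using assms(5) that by auto
  show ?case
  proof (rule Cn_on_SucI'[OF assms(1),
        where f'="\<lambda>v x. \<Sum>b\<in>Basis. (dirderiv v f x \<bullet> b) *\<^sub>R dirderiv b g (f x)"])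
    show "((\<lambda>x. g (f x)) has_derivative
        (\<lambda>v. \<Sum>b\<in>Basis. (dirderiv v f x \<bullet> b) *\<^sub>R dirderiv b g (f x))) (at x)" if x: "x \<in> S" for x
    proof -
      have g: "(g has_derivative (\<lambda>v. dirderiv v g (f x))) (at (f x))"
        by (rule Cn_on_SucE[OF Suc.prems(2) fT[OF x]])
      have lin: "linear (\<lambda>v. dirderiv v g (f x))"
        using g has_derivative_linear by blast
      have *: "dirderiv w g (f x) = (\<Sum>b\<in>Basis. (w \<bullet> b) *\<^sub>R dirderiv b g (f x))" for w
        using linear_sum[OF lin, of "\<lambda>b. (w \<bullet> b) *\<^sub>R b" Basis]
        by (simp add: euclidean_representation linear_scale[OF lin])
      show ?thesis
        unfolding *[of "dirderiv _ f x", symmetric]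
        by (rule has_derivative_compose[OF Cn_on_SucE[OF Suc.prems(1) x] g])
    qed
    show "Cn_on n S (\<lambda>x. \<Sum>b\<in>Basis. (dirderiv v f x \<bullet> b) *\<^sub>R dirderiv b g (f x))" for v
    proof (intro Cn_on_sum[OF assms(1)] Cn_on_bilinear[OF assms(1) bounded_bilinear_scaleR])
      fix b :: 'b
      show "Cn_on n S (\<lambda>x. dirderiv v f x \<bullet> b)"
        by (rule Cn_on_bounded_linear[OF assms(1) bounded_linear_inner_left Cn_on_SucD[OF Suc.prems(1)]])
      show "Cn_on n S (\<lambda>x. dirderiv b g (f x))"
        by (rule Suc.IH[OF Cn_on_lower[OF Suc.prems(1)] Cn_on_SucD[OF Suc.prems(2)]])
    qed
  qed
qed

lemma Cn_on_linear:
  assumes "open S" "bounded_linear L"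
  shows "Cn_on n S L"
proof (cases n)
  case 0
  then show ?thesis using assms(2) by (simp add: linear_continuous_on)
next
  case (Suc m)
  show ?thesis unfolding Suc
    by (rule Cn_on_SucI'[OF assms(1), where f'="\<lambda>v x. L v"])
      (auto simp: Cn_on_const intro: bounded_linear_imp_has_derivative assms)
qed

section \<open>Closure properties of smooth maps\<close>

lemma smooth_onD: "smooth_on S f \<Longrightarrow> Cn_on n S f"
  by (simp add: smooth_on_def)

lemma smooth_on_has_derivative:
  "smooth_on S f \<Longrightarrow> x \<in> S \<Longrightarrow> (f has_derivative (\<lambda>v. dirderiv v f x)) (at x)"
  using Cn_on_SucE smooth_onD by blast

lemma smooth_on_dirderiv: "smooth_on S f \<Longrightarrow> smooth_on S (dirderiv v f)"
  by (meson Cn_on_SucD smooth_on_def)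

lemma smooth_on_imp_continuous_on: "smooth_on S f \<Longrightarrow> continuous_on S f"
  by (metis Cn_on.simps(1) smooth_onD)

lemma smooth_on_subset: "smooth_on S f \<Longrightarrow> T \<subseteq> S \<Longrightarrow> smooth_on T f"
  unfolding smooth_on_def by (meson Cn_on_subset)

lemma smooth_on_const [simp]: "smooth_on S (\<lambda>x. c)"
  by (simp add: smooth_on_def Cn_on_const)

lemma smooth_on_bounded_linear:
  "open S \<Longrightarrow> bounded_linear L \<Longrightarrow> smooth_on S f \<Longrightarrow> smooth_on S (\<lambda>x. L (f x))"
  by (simp add: smooth_on_def Cn_on_bounded_linear)

lemma smooth_on_linear: "open S \<Longrightarrow> bounded_linear L \<Longrightarrow> smooth_on S L"
  by (simp add: smooth_on_def Cn_on_linear)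

lemma smooth_on_ident: "open S \<Longrightarrow> smooth_on S (\<lambda>x. x)"
  by (simp add: smooth_on_linear bounded_linear_ident)

lemma smooth_on_add:
  "open S \<Longrightarrow> smooth_on S f \<Longrightarrow> smooth_on S g \<Longrightarrow> smooth_on S (\<lambda>x. f x + g x)"
  by (simp add: smooth_on_def Cn_on_add)

lemma smooth_on_minus: "open S \<Longrightarrow> smooth_on S f \<Longrightarrow> smooth_on S (\<lambda>x. - f x)"
  by (rule smooth_on_bounded_linear[of S uminus]) (auto simp: bounded_linear_minus bounded_linear_ident)

lemma smooth_on_diff:
  "open S \<Longrightarrow> smooth_on S f \<Longrightarrow> smooth_on S g \<Longrightarrow> smooth_on S (\<lambda>x. f x - g x)"
  using smooth_on_add[OF _ _ smooth_on_minus, of S f g] by simp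

lemma smooth_on_sum:
  "open S \<Longrightarrow> (\<And>i. i \<in> I \<Longrightarrow> smooth_on S (f i)) \<Longrightarrow> smooth_on S (\<lambda>x. \<Sum>i\<in>I. f i x)"
  unfolding smooth_on_def by (auto intro: Cn_on_sum)

lemma smooth_on_bilinear:
  "open S \<Longrightarrow> bounded_bilinear B \<Longrightarrow> smooth_on S f \<Longrightarrow> smooth_on S g \<Longrightarrow>
    smooth_on S (\<lambda>x. B (f x) (g x))"
  by (simp add: smooth_on_def Cn_on_bilinear)

lemma smooth_on_mult:
  fixes f g :: "'a::real_normed_vector \<Rightarrow> real"
  shows "open S \<Longrightarrow> smooth_on S f \<Longrightarrow> smooth_on S g \<Longrightarrow> smooth_on S (\<lambda>x. f x * g x)"
  by (rule smooth_on_bilinear[OF _ bounded_bilinear_mult])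

lemma smooth_on_power:
  fixes f :: "'a::real_normed_vector \<Rightarrow> real"
  shows "open S \<Longrightarrow> smooth_on S f \<Longrightarrow> smooth_on S (\<lambda>x. f x ^ k)"
  by (induction k) (auto intro: smooth_on_mult)

lemma smooth_on_scaleR:
  "open S \<Longrightarrow> smooth_on S f \<Longrightarrow> smooth_on S g \<Longrightarrow> smooth_on S (\<lambda>x. f x *\<^sub>R g x)"
  by (rule smooth_on_bilinear[OF _ bounded_bilinear_scaleR])

lemma smooth_on_inner:
  "open S \<Longrightarrow> smooth_on S f \<Longrightarrow> smooth_on S g \<Longrightarrow> smooth_on S (\<lambda>x. f x \<bullet> g x)"
  by (rule smooth_on_bilinear[OF _ bounded_bilinear_inner])

lemma smooth_on_compose:
  fixes g :: "'b::euclidean_space \<Rightarrow> 'c::real_normed_vector"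
  shows "open S \<Longrightarrow> open T \<Longrightarrow> smooth_on S f \<Longrightarrow> smooth_on T g \<Longrightarrow> (\<And>x. x \<in> S \<Longrightarrow> f x \<in> T) \<Longrightarrow>
    smooth_on S (\<lambda>x. g (f x))"
  unfolding smooth_on_def by (metis Cn_on_compose image_subsetI)

lemma smooth_on_nth: "open S \<Longrightarrow> smooth_on S f \<Longrightarrow> smooth_on S (\<lambda>x. f x $ k)"
  by (rule smooth_on_bounded_linear[OF _ bounded_linear_vec_nth])

lemma smooth_on_vec:
  fixes f :: "'a::real_normed_vector \<Rightarrow> 'b::euclidean_space ^ 'n::finite"
  assumes "open S" "\<And>k. smooth_on S (\<lambda>x. f x $ k)"
  shows "smooth_on S f"
proof -
  have "smooth_on S (\<lambda>x. \<Sum>b\<in>Basis. (f x \<bullet> b) *\<^sub>R b)"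
  proof (intro smooth_on_sum smooth_on_scaleR assms(1) smooth_on_const)
    fix b :: "'b^'n" assume "b \<in> Basis"
    then obtain k u where "b = axis k u" by (auto simp: Basis_vec_def)
    then show "smooth_on S (\<lambda>x. f x \<bullet> b)"
      by (simp add: inner_axis smooth_on_inner assms)
  qed
  then show ?thesis by (simp add: euclidean_representation)
qed

lemma smooth_on_Pair:
  assumes "open S" "smooth_on S f" "smooth_on S g"
  shows "smooth_on S (\<lambda>x. (f x, g x))"
proof -
  have "smooth_on S (\<lambda>x. (f x, 0) + (0, g x))"
    by (intro smooth_on_add assms smooth_on_bounded_linear[where L="\<lambda>y. (y, 0)"]
        smooth_on_bounded_linear[where L="\<lambda>y. (0, y)"] bounded_linear_Pair
        bounded_linear_ident bounded_linear_zero)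
  then show ?thesis by simp
qed

lemma smooth_on_fst: "open S \<Longrightarrow> smooth_on S f \<Longrightarrow> smooth_on S (\<lambda>x. fst (f x))"
  by (rule smooth_on_bounded_linear[OF _ bounded_linear_fst])

lemma smooth_on_snd: "open S \<Longrightarrow> smooth_on S f \<Longrightarrow> smooth_on S (\<lambda>x. snd (f x))"
  by (rule smooth_on_bounded_linear[OF _ bounded_linear_snd])

lemmas smooth_intros = smooth_on_const smooth_on_ident smooth_on_add smooth_on_diff smooth_on_minus
  smooth_on_sum smooth_on_mult smooth_on_power smooth_on_scaleR smooth_on_inner smooth_on_nth
  smooth_on_Pair smooth_on_fst smooth_on_snd

subsection \<open>Inverses of smooth families of operators and the inverse function theorem\<close>

text \<open>A product rule in which one factor is merely continuous: the other one vanishes at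
  \<open>x\<close>, so the increment of the first contributes only at second order. This gives
  derivatives of objects whose differentiability is not yet known.\<close>

lemma has_derivative_scaleR_vanishing:
  fixes p :: "'a::real_normed_vector \<Rightarrow> real" and F :: "'a \<Rightarrow> 'b::real_normed_vector"
  assumes p: "isCont p x" and F: "(F has_derivative F') (at x)" and 0: "F x = 0"
  shows "((\<lambda>y. p y *\<^sub>R F y) has_derivative (\<lambda>v. p x *\<^sub>R F' v)) (at x)"
proof -
  interpret F': bounded_linear F' by (rule has_derivative_bounded_linear[OF F])
  have "((\<lambda>y. (p y - p x) *\<^sub>R F y) has_derivative (\<lambda>v. 0)) (at x)"
  proof (rule has_derivativeI)
    obtain K where K: "K > 0" "\<And>v. norm (F' v) \<le> norm v * K"
      using F'.pos_bounded by blast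
    have lim: "((\<lambda>y. norm (F y - F x - F' (y - x)) / norm (y - x)) \<longlongrightarrow> 0) (at x)"
      using F by (simp add: has_derivative_iff_norm)
    have p0: "((\<lambda>y. \<bar>p y - p x\<bar>) \<longlongrightarrow> 0) (at x)"
      using p by (simp add: isCont_def LIM_zero tendsto_rabs_zero)
    have "((\<lambda>y. \<bar>p y - p x\<bar> * (norm (F y - F x - F' (y - x)) / norm (y - x) + K)) \<longlongrightarrow> 0 * (0 + K)) (at x)"
      by (intro tendsto_intros lim p0)
    then have bound: "((\<lambda>y. \<bar>p y - p x\<bar> * (norm (F y - F x - F' (y - x)) / norm (y - x) + K)) \<longlongrightarrow> 0) (at x)"
      by simp
    show "((\<lambda>y. ((p y - p x) *\<^sub>R F y - (p x - p x) *\<^sub>R F x - 0) /\<^sub>R norm (y - x)) \<longlongrightarrow> 0) (at x)"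
    proof (rule Lim_null_comparison[OF _ bound], rule eventuallyI)
      fix y
      have "norm (F y) \<le> norm (F y - F x - F' (y - x)) + norm (y - x) * K"
        using norm_triangle_ineq[of "F y - F' (y - x)" "F' (y - x)"] K(2)[of "y - x"] by (simp add: 0)
      then have "norm (F y) / norm (y - x) \<le> norm (F y - F x - F' (y - x)) / norm (y - x) + K" if "y \<noteq> x"
        using that by (simp add: field_simps)
      then have "\<bar>p y - p x\<bar> * (norm (F y) / norm (y - x))
          \<le> \<bar>p y - p x\<bar> * (norm (F y - F x - F' (y - x)) / norm (y - x) + K)"
        using K(1) by (cases "y = x") (auto intro!: mult_left_mono simp del: times_divide_eq_right)
      then show "norm (((p y - p x) *\<^sub>R F y - (p x - p x) *\<^sub>R F x - 0) /\<^sub>R norm (y - x))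
          \<le> \<bar>p y - p x\<bar> * (norm (F y - F x - F' (y - x)) / norm (y - x) + K)"
        by (simp add: divide_inverse mult_ac abs_mult)
    qed
  qed auto
  from has_derivative_add[OF this has_derivative_scaleR_right[OF F, of "p x"]]
  show ?thesis by (simp add: algebra_simps)
qed

lemma linear_eq_sum_Basis:
  fixes L :: "'a::euclidean_space \<Rightarrow> 'b::real_vector"
  assumes "linear L"
  shows "L w = (\<Sum>b\<in>Basis. (w \<bullet> b) *\<^sub>R L b)"
  using linear_sum[OF assms, of "\<lambda>b. (w \<bullet> b) *\<^sub>R b" Basis]
  by (simp add: euclidean_representation linear_scale[OF assms])

context
  fixes A :: "'b::real_normed_vector \<Rightarrow> 'a::euclidean_space \<Rightarrow> 'a" and V :: "'b set"
  assumes lin: "\<And>y. y \<in> V \<Longrightarrow> linear (A y)" and inj: "\<And>y. y \<in> V \<Longrightarrow> inj (A y)"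
    and V: "open V"
begin

lemma bij_family: "y \<in> V \<Longrightarrow> bij (A y)"
  by (simp add: bij_def inj linear_injective_imp_surjective lin)

lemma linear_inv_family: "y \<in> V \<Longrightarrow> linear (inv (A y))"
  using bij_family lin by (metis inj_linear_imp_inv_linear inj)

text \<open>The resolvent identity, with the inner vector expanded in a basis: only the maps
  \<open>\<lambda>y. A y b\<close> for fixed \<open>b\<close> are assumed regular, and each vector
  in the sum vanishes at \<open>y = y0\<close>.\<close>

lemma inv_family_expansion:
  assumes "y0 \<in> V" "y \<in> V"
  shows "inv (A y) v = inv (A y0) v
    + (\<Sum>b\<in>Basis. (inv (A y) v \<bullet> b) *\<^sub>R inv (A y0) (A y0 b - A y b))"
proof -
  let ?h = "inv (A y) v"
  interpret I: linear "inv (A y0)" by (rule linear_inv_family[OF assms(1)])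
  have "A y0 ?h = v + (A y0 ?h - A y ?h)"
    using bij_family[OF assms(2)] by (simp add: bij_is_surj surj_f_inv_f)
  also have "A y0 ?h - A y ?h = (\<Sum>b\<in>Basis. (?h \<bullet> b) *\<^sub>R (A y0 b - A y b))"
    using linear_eq_sum_Basis[OF lin[OF assms(1)], of ?h] linear_eq_sum_Basis[OF lin[OF assms(2)], of ?h]
    by (simp add: sum_subtractf scaleR_diff_right)
  finally have "inv (A y0) (A y0 ?h) = inv (A y0) (v + (\<Sum>b\<in>Basis. (?h \<bullet> b) *\<^sub>R (A y0 b - A y b)))"
    by simp
  moreover have "inv (A y0) (A y0 ?h) = ?h"
    by (simp add: inv_f_f inj assms)
  ultimately show ?thesis
    by (simp add: I.add I.sum I.scale)
qed

text \<open>The unknown \<open>inv (A y) v\<close> occurs on both sides of the expansion. Once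
  \<open>\<epsilon> y < 1/2\<close>, half of its variation can be absorbed into the left
  side.\<close>

lemma continuous_on_inv_family:
  assumes cont: "\<And>b. continuous_on V (\<lambda>y. A y b)"
  shows "continuous_on V (\<lambda>y. inv (A y) v)"
proof (rule continuous_at_imp_continuous_on, rule ballI)
  fix y0 assume y0: "y0 \<in> V"
  let ?h = "\<lambda>y. inv (A y) v"
  define \<epsilon> where "\<epsilon> y = (\<Sum>b\<in>Basis. norm (inv (A y0) (A y0 b - A y b)))" for y
  have linI: "linear (inv (A y0))" by (rule linear_inv_family[OF y0])
  have "isCont (\<lambda>y. A y b) y0" for b
    using cont y0 V by (auto simp: continuous_on_eq_continuous_at)
  then have "isCont (\<lambda>y. inv (A y0) (A y0 b - A y b)) y0" for b
    by (intro bounded_linear.continuous[OF linI[unfolded linear_conv_bounded_linear]] continuous_intros)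
  then have "isCont \<epsilon> y0"
    unfolding \<epsilon>_def by (intro continuous_intros)
  then have lim: "(\<epsilon> \<longlongrightarrow> 0) (at y0)"
    by (simp add: isCont_def \<epsilon>_def linear_0[OF linI])
  have main: "norm (?h y - ?h y0) \<le> 2 * norm (?h y0) * \<epsilon> y" if y: "y \<in> V" and "\<epsilon> y < 1/2" for y
  proof -
    have "norm (?h y - ?h y0) = norm (\<Sum>b\<in>Basis. (?h y \<bullet> b) *\<^sub>R inv (A y0) (A y0 b - A y b))"
      by (subst inv_family_expansion[OF y0 y]) simp
    also have "\<dots> \<le> (\<Sum>b\<in>Basis. norm (?h y) * norm (inv (A y0) (A y0 b - A y b)))"
      by (intro order_trans[OF norm_sum] sum_mono) (simp add: Basis_le_norm mult_right_mono)
    also have "\<dots> = norm (?h y) * \<epsilon> y"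
      by (simp add: \<epsilon>_def sum_distrib_left)
    also have "\<dots> \<le> (norm (?h y - ?h y0) + norm (?h y0)) * \<epsilon> y"
      using norm_triangle_ineq[of "?h y - ?h y0" "?h y0"]
      by (intro mult_right_mono) (auto simp: \<epsilon>_def sum_nonneg)
    also have "\<dots> \<le> norm (?h y - ?h y0) * (1/2) + norm (?h y0) * \<epsilon> y"
      using mult_left_mono[of "\<epsilon> y" "1/2" "norm (?h y - ?h y0)"] that(2) by (simp add: distrib_right)
    finally show ?thesis by simp
  qed
  have "((\<lambda>y. ?h y - ?h y0) \<longlongrightarrow> 0) (at y0)"
  proof (rule Lim_null_comparison)
    have "eventually (\<lambda>y. \<epsilon> y < 1/2) (at y0)"
      using order_tendstoD(2)[OF lim, of "1/2"] by simp
    moreover have "eventually (\<lambda>y. y \<in> V) (at y0)"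
      using V y0 by (simp add: eventually_at_topological) blast
    ultimately show "eventually (\<lambda>y. norm (?h y - ?h y0) \<le> 2 * norm (?h y0) * \<epsilon> y) (at y0)"
      by eventually_elim (rule main)
    show "((\<lambda>y. 2 * norm (?h y0) * \<epsilon> y) \<longlongrightarrow> 0) (at y0)"
      using tendsto_mult_right_zero[OF lim] by simp
  qed
  then show "isCont ?h y0"
    by (simp add: isCont_def LIM_zero_iff)
qed

text \<open>In the expansion the coefficients are only known to be continuous, but they multiply
  vectors vanishing at \<open>y0\<close>. The result is the familiar derivative of inversion, minus
  the inverse times \<open>A'\<close> times the inverse.\<close>

lemma has_derivative_inv_family:
  assumes der: "\<And>b. ((\<lambda>y. A y b) has_derivative (\<lambda>w. A' w b)) (at y0)" and y0: "y0 \<in> V"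
    and cont: "isCont (\<lambda>y. inv (A y) v) y0"
  shows "((\<lambda>y. inv (A y) v) has_derivative
    (\<lambda>w. - (\<Sum>b\<in>Basis. (inv (A y0) v \<bullet> b) *\<^sub>R inv (A y0) (A' w b)))) (at y0)"
proof (rule has_derivative_transform_within_open[OF _ V y0 inv_family_expansion[OF y0, symmetric]])
  have I: "bounded_linear (inv (A y0))"
    by (simp add: linear_conv_bounded_linear[symmetric] linear_inv_family[OF y0])
  have "((\<lambda>y. inv (A y0) v + (\<Sum>b\<in>Basis. (inv (A y) v \<bullet> b) *\<^sub>R inv (A y0) (A y0 b - A y b)))
    has_derivative (\<lambda>w. 0 + (\<Sum>b\<in>Basis. (inv (A y0) v \<bullet> b) *\<^sub>R inv (A y0) (0 - A' w b)))) (at y0)"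
    by (intro has_derivative_add has_derivative_const has_derivative_sum has_derivative_scaleR_vanishing
        bounded_linear.has_derivative[OF I] has_derivative_diff der continuous_intros cont)
      (simp add: linear_0[OF linear_inv_family[OF y0]])
  moreover have "inv (A y0) (0 - x) = - inv (A y0) x" for x
    using linear_neg[OF linear_inv_family[OF y0]] by simp
  ultimately show "((\<lambda>y. inv (A y0) v + (\<Sum>b\<in>Basis. (inv (A y) v \<bullet> b) *\<^sub>R inv (A y0) (A y0 b - A y b)))
    has_derivative (\<lambda>w. - (\<Sum>b\<in>Basis. (inv (A y0) v \<bullet> b) *\<^sub>R inv (A y0) (A' w b)))) (at y0)"
    by (simp add: sum_negf)
qed

text \<open>The derivative formula involves only inverses again and first derivatives of
  \<open>A\<close>, so regularity climbs by one order at each step.\<close>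

lemma Cn_on_inv_family:
  assumes "\<And>b. Cn_on n V (\<lambda>y. A y b)"
  shows "Cn_on n V (\<lambda>y. inv (A y) v)"
  using assms
proof (induction n arbitrary: v)
  case 0
  then show ?case by (simp add: continuous_on_inv_family)
next
  case (Suc n)
  have IH: "Cn_on n V (\<lambda>y. inv (A y) v)" for v
    using Suc by (blast intro: Cn_on_lower)
  show ?case
  proof (rule Cn_on_SucI'[OF V, where
        f'="\<lambda>w y. - (\<Sum>b\<in>Basis. (inv (A y) v \<bullet> b) *\<^sub>R inv (A y) (dirderiv w (\<lambda>y. A y b) y))"])
    fix y assume y: "y \<in> V"
    show "((\<lambda>y. inv (A y) v) has_derivative
      (\<lambda>w. - (\<Sum>b\<in>Basis. (inv (A y) v \<bullet> b) *\<^sub>R inv (A y) (dirderiv w (\<lambda>y. A y b) y)))) (at y)"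
    proof (rule has_derivative_inv_family[OF Cn_on_SucE[OF Suc.prems y] y])
      show "isCont (\<lambda>y. inv (A y) v) y"
        using Cn_on_mono[OF IH le0, of v] y V by (simp add: continuous_on_eq_continuous_at)
    qed
  next
    fix w
    \<comment> \<open>The induction hypothesis treats a constant argument; the basis expansion
      extends it to an argument that varies with \<open>y\<close>.\<close>
    have "Cn_on n V (\<lambda>y. inv (A y) (g y))" if g: "Cn_on n V g" for g
    proof (rule Cn_on_cong_imp[OF V])
      show "Cn_on n V (\<lambda>y. \<Sum>b\<in>Basis. (g y \<bullet> b) *\<^sub>R inv (A y) b)"
        by (intro Cn_on_sum[OF V] Cn_on_bilinear[OF V bounded_bilinear_scaleR] IH
            Cn_on_bounded_linear[OF V bounded_linear_inner_left g])
      show "\<And>y. y \<in> V \<Longrightarrow> (\<Sum>b\<in>Basis. (g y \<bullet> b) *\<^sub>R inv (A y) b) = inv (A y) (g y)"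
        by (rule linear_eq_sum_Basis[symmetric, OF linear_inv_family])
    qed
    then have "Cn_on n V (\<lambda>y. inv (A y) (dirderiv w (\<lambda>y. A y b) y))" for b
      using Suc.prems by (blast intro: Cn_on_SucD)
    then show "Cn_on n V (\<lambda>y. - (\<Sum>b\<in>Basis. (inv (A y) v \<bullet> b) *\<^sub>R inv (A y) (dirderiv w (\<lambda>y. A y b) y)))"
      by (intro Cn_on_bounded_linear[OF V bounded_linear_minus[OF bounded_linear_ident]] Cn_on_sum[OF V]
          Cn_on_bilinear[OF V bounded_bilinear_scaleR]
          Cn_on_bounded_linear[OF V bounded_linear_inner_left IH])
  qed
qed

end

text \<open>The continuously differentiable inverse \<open>g\<close> comes from the classical
  theorem. Its derivative at \<open>y\<close> is the inverse of the derivative of \<open>f\<close>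
  at \<open>g y\<close>, which has as many derivatives as \<open>g\<close>; induction then makes
  \<open>g\<close> smooth.\<close>

theorem smooth_inverse_function:
  fixes f :: "'a::euclidean_space \<Rightarrow> 'a"
  assumes S: "open S" and f: "smooth_on S f" and x0: "x0 \<in> S"
    and inj: "\<And>v. dirderiv v f x0 = 0 \<Longrightarrow> v = 0"
  obtains U g where "open U" "U \<subseteq> S" "x0 \<in> U" "open (f ` U)" "smooth_on (f ` U) g"
    "\<And>x. x \<in> U \<Longrightarrow> g (f x) = x"
proof -
  define f' where "f' x = Blinfun (\<lambda>v. dirderiv v f x)" for x
  have der: "(f has_derivative (\<lambda>v. dirderiv v f x)) (at x)" if "x \<in> S" for x
    by (rule smooth_on_has_derivative[OF f that])
  have f': "blinfun_apply (f' x) = (\<lambda>v. dirderiv v f x)" if "x \<in> S" for x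
    unfolding f'_def by (rule bounded_linear_Blinfun_apply has_derivative_bounded_linear[OF der[OF that]])+
  have contf': "continuous_on S f'"
  proof (rule continuous_on_blinfun_componentwise)
    fix b :: 'a
    have "continuous_on S (dirderiv b f)"
      by (intro smooth_on_imp_continuous_on smooth_on_dirderiv f)
    then show "continuous_on S (\<lambda>x. blinfun_apply (f' x) b)"
      by (rule continuous_on_eq) (simp add: f')
  qed
  have lin0: "linear (\<lambda>v. dirderiv v f x0)"
    using der[OF x0] has_derivative_linear by blast
  have "inj (\<lambda>v. dirderiv v f x0)"
    using inj by (simp add: linear_injective_0[OF lin0])
  then obtain L where L: "linear L" "L \<circ> (\<lambda>v. dirderiv v f x0) = id"
    using linear_injective_left_inverse[OF lin0] by blast
  have invf: "Blinfun L o\<^sub>L f' x0 = id_blinfun"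
    using L by (auto intro!: blinfun_eqI simp: f'[OF x0] bounded_linear_Blinfun_apply
        linear_conv_bounded_linear fun_eq_iff)
  obtain U V g g' where U: "open U" "U \<subseteq> S" "x0 \<in> U" "open V" "f x0 \<in> V" and hom: "homeomorphism U V f g"
    and derg: "\<And>y. y \<in> V \<Longrightarrow> (g has_derivative (g' y)) (at y)"
    and g': "\<And>y. y \<in> V \<Longrightarrow> g' y = inv (blinfun_apply (f'(g y)))"
    and bij: "\<And>y. y \<in> V \<Longrightarrow> bij (blinfun_apply (f'(g y)))"
  proof (rule inverse_function_theorem[OF S _ contf' x0 invf])
    show "(f has_derivative blinfun_apply (f' x)) (at x)" if "x \<in> S" for x
      using der[OF that] f'[OF that] by simp
  qed (rule that)
  have gU: "g y \<in> U" if "y \<in> V" for y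
    using hom that by (auto simp: homeomorphism_def)
  then have gS: "g y \<in> S" if "y \<in> V" for y using that U(2) by auto
  define A where "A y v = dirderiv v f (g y)" for y v
  have f'A: "blinfun_apply (f' (g y)) = A y" if "y \<in> V" for y
    unfolding f'[OF gS[OF that]] A_def ..
  have lin: "linear (A y)" if "y \<in> V" for y
    using f'A[OF that] by (metis blinfun.bounded_linear_right bounded_linear.linear)
  have injA: "inj (A y)" if "y \<in> V" for y
    using bij[OF that] f'A[OF that] by (simp add: bij_is_inj)
  have "Cn_on n V g" for n
  proof (induction n)
    case 0
    show ?case using hom by (simp add: homeomorphism_def)
  next
    case (Suc n)
    show ?case
    proof (rule Cn_on_SucI'[OF U(4), where f'="\<lambda>v y. inv (A y) v"])
      show "(g has_derivative (\<lambda>v. inv (A y) v)) (at y)" if "y \<in> V" for y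
        using derg[OF that] g'[OF that] f'A[OF that] by simp
      have "Cn_on n V (\<lambda>y. A y b)" for b
        unfolding A_def
        by (rule Cn_on_compose[OF U(4) U(1) Suc.IH, of "dirderiv b f"])
          (use f gU U(2) in \<open>auto intro!: smooth_onD smooth_on_dirderiv intro: smooth_on_subset\<close>)
      then show "Cn_on n V (\<lambda>y. inv (A y) v)" for v
        by (intro Cn_on_inv_family lin injA U(4)) auto
    qed
  qed
  then have "smooth_on V g" by (simp add: smooth_on_def)
  moreover have "f ` U = V" "\<And>x. x \<in> U \<Longrightarrow> g (f x) = x"
    using hom by (auto simp: homeomorphism_def)
  ultimately show thesis
    using that[of U g] U by simp
qed

subsection \<open>Integrals with parameters, symmetry of derivatives, Taylor expansion\<close>

lemma smooth_on_UNIV_has_derivative: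
  "smooth_on UNIV f \<Longrightarrow> (f has_derivative (\<lambda>v. dirderiv v f x)) (at x)"
  by (rule smooth_on_has_derivative) auto

lemma
  assumes "smooth_on UNIV f"
  shows dirderiv_add: "dirderiv (u + v) f x = dirderiv u f x + dirderiv v f x"
    and dirderiv_scaleR: "dirderiv (c *\<^sub>R v) f x = c *\<^sub>R dirderiv v f x"
    and dirderiv_sum: "dirderiv (\<Sum>i\<in>I. w i) f x = (\<Sum>i\<in>I. dirderiv (w i) f x)"
proof -
  have "linear (\<lambda>v. dirderiv v f x)"
    by (rule has_derivative_linear[OF smooth_on_UNIV_has_derivative[OF assms]])
  then interpret linear "\<lambda>v. dirderiv v f x" .
  show "dirderiv (u + v) f x = dirderiv u f x + dirderiv v f x" by (rule add)
  show "dirderiv (c *\<^sub>R v) f x = c *\<^sub>R dirderiv v f x" by (rule scale)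
  show "dirderiv (\<Sum>i\<in>I. w i) f x = (\<Sum>i\<in>I. dirderiv (w i) f x)" by (rule sum)
qed

lemma dirderiv_linear_combination:
  fixes f g :: "'a::real_normed_vector \<Rightarrow> real"
  assumes "smooth_on UNIV f" "smooth_on UNIV g"
  shows "dirderiv v (\<lambda>z. a * f z + b * g z) = (\<lambda>z. a * dirderiv v f z + b * dirderiv v g z)"
proof
  fix x
  have "((\<lambda>z. a * f z + b * g z) has_derivative (\<lambda>v. a * dirderiv v f x + b * dirderiv v g x)) (at x)"
    by (intro has_derivative_add has_derivative_mult_right smooth_on_UNIV_has_derivative assms)
  then show "dirderiv v (\<lambda>z. a * f z + b * g z) x = a * dirderiv v f x + b * dirderiv v g x"
    by (rule dirderiv_eqI)
qed

lemma dirderiv_sum_functions: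
  fixes f :: "'i \<Rightarrow> 'a::real_normed_vector \<Rightarrow> real"
  assumes "\<And>i. smooth_on UNIV (f i)"
  shows "dirderiv v (\<lambda>z. \<Sum>i\<in>I. a i * f i z) = (\<lambda>z. \<Sum>i\<in>I. a i * dirderiv v (f i) z)"
proof
  fix x
  have "((\<lambda>z. \<Sum>i\<in>I. a i * f i z) has_derivative (\<lambda>v. \<Sum>i\<in>I. a i * dirderiv v (f i) x)) (at x)"
    by (intro has_derivative_sum has_derivative_mult_right smooth_on_UNIV_has_derivative assms)
  then show "dirderiv v (\<lambda>z. \<Sum>i\<in>I. a i * f i z) x = (\<Sum>i\<in>I. a i * dirderiv v (f i) x)"
    by (rule dirderiv_eqI)
qed

section \<open>Differentiation under the integral sign\<close>

lemma continuous_on_param_integrand: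
  fixes G :: "'a::real_normed_vector \<Rightarrow> 'b::real_normed_vector"
  assumes "continuous_on UNIV G" "continuous_on {0..1} w" "continuous_on {0..1} c"
    and "bounded_linear P" "bounded_linear R"
  shows "continuous_on (UNIV \<times> {0..1::real}) (\<lambda>(z, t). w t *\<^sub>R G (c t + P z + t *\<^sub>R R z))"
proof -
  have w: "continuous_on (UNIV \<times> {0..1::real}) (\<lambda>z. w (snd z))"
    and c: "continuous_on (UNIV \<times> {0..1::real}) (\<lambda>z. c (snd z))"
    by (auto intro!: continuous_on_compose2[OF assms(2)] continuous_on_compose2[OF assms(3)]
        continuous_intros)
  show ?thesis
    unfolding split_def
    by (intro continuous_intros w c continuous_on_compose2[OF assms(1)]
        bounded_linear.continuous_on[OF assms(4)] bounded_linear.continuous_on[OF assms(5)]) auto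
qed

text \<open>The maps \<open>P\<close> and \<open>R\<close> serve Taylor remainders along segments
  from \<open>P z\<close> to \<open>P z + R z\<close>; the offset \<open>c t\<close> serves the
  symmetry of second derivatives, where the segment is a translate by a multiple of a fixed
  vector.\<close>

lemma has_derivative_param_integral:
  fixes G :: "'a::euclidean_space \<Rightarrow> 'b::banach" and P R :: "'a \<Rightarrow> 'a"
  assumes G: "Cn_on 1 UNIV G" and w: "continuous_on {0..1} w" and c: "continuous_on {0..1} c"
    and P: "bounded_linear P" and R: "bounded_linear R"
  shows "((\<lambda>z. integral {0..1} (\<lambda>t. w t *\<^sub>R G (c t + P z + t *\<^sub>R R z))) has_derivative
    (\<lambda>v. integral {0..1} (\<lambda>t. w t *\<^sub>R dirderiv (P v + t *\<^sub>R R v) G (c t + P z + t *\<^sub>R R z)))) (at z)"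
proof -
  interpret P: bounded_linear P by fact
  interpret R: bounded_linear R by fact
  define D where "D z t v = w t *\<^sub>R dirderiv (P v + t *\<^sub>R R v) G (c t + P z + t *\<^sub>R R z)" for z t v
  have derG: "(G has_derivative (\<lambda>v. dirderiv v G x)) (at x)" for x
    using Cn_on_SucE[of 0 UNIV G x] G by simp
  have contdG: "continuous_on UNIV (dirderiv b G)" for b
    using Cn_on_SucD[of 0 UNIV G b] G by simp
  have der: "((\<lambda>z. w t *\<^sub>R G (c t + P z + t *\<^sub>R R z)) has_derivative D z t) (at z)" for z t
    unfolding D_def
    by (intro has_derivative_scaleR_right has_derivative_compose[OF _ derG])
      (auto intro!: derivative_eq_intros P.has_derivative R.has_derivative)
  define D' where "D' z t = Blinfun (D z t)" for z t
  have D': "blinfun_apply (D' z t) = D z t" for z t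
    unfolding D'_def by (rule bounded_linear_Blinfun_apply[OF has_derivative_bounded_linear[OF der]])
  have contD: "continuous_on (UNIV \<times> {0..1}) (\<lambda>(z, t). D z t v)" for v
  proof -
    have eq: "D z t v = (\<Sum>b\<in>Basis. ((P v + t *\<^sub>R R v) \<bullet> b) *\<^sub>R (w t *\<^sub>R dirderiv b G (c t + P z + t *\<^sub>R R z)))" for z t
      unfolding D_def
      by (subst linear_eq_sum_Basis[OF has_derivative_linear[OF derG]])
        (simp add: scaleR_sum_right mult.commute)
    have "continuous_on (UNIV \<times> {0..1::real}) (\<lambda>(z, t). ((P v + t *\<^sub>R R v) \<bullet> b) *\<^sub>R (w t *\<^sub>R dirderiv b G (c t + P z + t *\<^sub>R R z)))" for b
      using continuous_on_param_integrand[OF contdG[of b] w c P R]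
      unfolding split_def
      by (intro continuous_on_scaleR[OF continuous_on_inner]) (auto intro!: continuous_intros
          P.continuous_on R.continuous_on)
    then show ?thesis
      unfolding eq split_def by (intro continuous_on_sum)
  qed
  have contD': "continuous_on (UNIV \<times> {0..1}) (\<lambda>(z, t). D' z t)"
    unfolding split_def
    by (rule continuous_on_blinfun_componentwise) (use contD in \<open>simp add: D' split_def\<close>)
  have cont: "continuous_on (UNIV \<times> {0..1::real}) (\<lambda>(z, t). w t *\<^sub>R G (c t + P z + t *\<^sub>R R z))"
    by (rule continuous_on_param_integrand[OF _ w c P R])
      (use Cn_on_mono[OF G, of 0] in simp)
  have slice: "continuous_on {0..1} (h z)" if "continuous_on (UNIV \<times> {0..1::real}) (\<lambda>(z::'a, t). h z t)"
    for h :: "'a \<Rightarrow> real \<Rightarrow> 'c::real_normed_vector" and z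
    using continuous_on_compose2[OF that, of "{0..1}" "Pair z"]
    by (auto simp: continuous_on_Pair continuous_on_id)
  have "((\<lambda>z. integral (cbox 0 1) (\<lambda>t. w t *\<^sub>R G (c t + P z + t *\<^sub>R R z))) has_derivative
      blinfun_apply (integral (cbox 0 1) (D' z))) (at z within UNIV)"
    by (rule leibniz_rule[where U=UNIV])
      (use der slice[OF cont] contD' in \<open>auto simp: D' intro!: integrable_continuous_real\<close>)
  moreover have "blinfun_apply (integral (cbox 0 1) (D' z)) = (\<lambda>v. integral {0..1} (\<lambda>t. D z t v))"
    using blinfun_apply_integral[of "D' z" "cbox 0 1"] slice[OF contD', of z]
    by (simp add: D' integrable_continuous_real fun_eq_iff)
  ultimately show ?thesis
    unfolding D_def by simp
qed

text \<open>Differentiating along \<open>t *\<^sub>R R z\<close> brings out a factor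
  \<open>t\<close>, so the induction has to run over all continuous weights \<open>w\<close> at
  once.\<close>

lemma Cn_on_param_integral:
  fixes G :: "'a::euclidean_space \<Rightarrow> 'b::banach" and P R :: "'a \<Rightarrow> 'a"
  assumes P: "bounded_linear P" and R: "bounded_linear R"
    and "Cn_on n UNIV G" "continuous_on {0..1} w"
  shows "Cn_on n UNIV (\<lambda>z. integral {0..1} (\<lambda>t. w t *\<^sub>R G (P z + t *\<^sub>R R z)))"
  using assms(3,4)
proof (induction n arbitrary: G w)
  case 0
  have "continuous_on (UNIV \<times> cbox 0 1) (\<lambda>(z, t). w t *\<^sub>R G (P z + t *\<^sub>R R z))"
    using continuous_on_param_integrand[of G w "\<lambda>_. 0" P R] 0 P R by simp
  from integral_continuous_on_param[OF this] show ?case by simp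
next
  case (Suc n)
  have dG: "Cn_on n UNIV (dirderiv b G)" for b
    by (rule Cn_on_SucD[OF Suc.prems(1)])
  have integ: "(\<lambda>t. u t *\<^sub>R dirderiv b G (P z + t *\<^sub>R R z)) integrable_on {0..1}"
    if "continuous_on {0..1} u" for u b z
  proof (rule integrable_continuous_real)
    have "continuous_on UNIV (dirderiv b G)"
      using Cn_on_mono[OF dG le0, of b] by simp
    then show "continuous_on {0..1} (\<lambda>t. u t *\<^sub>R dirderiv b G (P z + t *\<^sub>R R z))"
      by (rule continuous_on_scaleR[OF that continuous_on_compose2[where g="dirderiv b G"]])
        (auto intro!: continuous_on_add continuous_on_scaleR continuous_on_const continuous_on_id)
  qed
  have wt: "continuous_on {0..1} (\<lambda>t. w t * t)"
    by (intro continuous_intros Suc.prems)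
  show ?case
  proof (rule Cn_on_SucI'[OF open_UNIV, where f'="\<lambda>v z.
        integral {0..1} (\<lambda>t. w t *\<^sub>R dirderiv (P v) G (P z + t *\<^sub>R R z))
        + integral {0..1} (\<lambda>t. (w t * t) *\<^sub>R dirderiv (R v) G (P z + t *\<^sub>R R z))"])
    fix z
    have lin: "linear (\<lambda>v. dirderiv v G x)" for x
      by (rule has_derivative_linear[OF Cn_on_SucE[OF Suc.prems(1) UNIV_I]])
    have "integral {0..1} (\<lambda>t. w t *\<^sub>R dirderiv (P v + t *\<^sub>R R v) G (P z + t *\<^sub>R R z))
      = integral {0..1} (\<lambda>t. w t *\<^sub>R dirderiv (P v) G (P z + t *\<^sub>R R z))
        + integral {0..1} (\<lambda>t. (w t * t) *\<^sub>R dirderiv (R v) G (P z + t *\<^sub>R R z))" for v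
      by (subst integral_add[symmetric, OF integ[OF Suc.prems(2)] integ[OF wt]])
        (simp add: linear_add[OF lin] linear_scale[OF lin] scaleR_add_right)
    then show "((\<lambda>z. integral {0..1} (\<lambda>t. w t *\<^sub>R G (P z + t *\<^sub>R R z))) has_derivative
      (\<lambda>v. integral {0..1} (\<lambda>t. w t *\<^sub>R dirderiv (P v) G (P z + t *\<^sub>R R z))
        + integral {0..1} (\<lambda>t. (w t * t) *\<^sub>R dirderiv (R v) G (P z + t *\<^sub>R R z)))) (at z)"
      using has_derivative_param_integral[OF Cn_on_mono[OF Suc.prems(1)] Suc.prems(2) _ P R,
          of "\<lambda>_. 0" z] by simp
  next
    fix v
    show "Cn_on n UNIV (\<lambda>z. integral {0..1} (\<lambda>t. w t *\<^sub>R dirderiv (P v) G (P z + t *\<^sub>R R z))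
        + integral {0..1} (\<lambda>t. (w t * t) *\<^sub>R dirderiv (R v) G (P z + t *\<^sub>R R z)))"
      by (intro Cn_on_add open_UNIV Suc.IH dG Suc.prems(2) wt)
  qed
qed

lemma smooth_on_param_integral:
  fixes G :: "'a::euclidean_space \<Rightarrow> 'b::banach" and P R :: "'a \<Rightarrow> 'a"
  assumes "bounded_linear P" "bounded_linear R" "smooth_on UNIV G" "continuous_on {0..1} w"
  shows "smooth_on UNIV (\<lambda>z. integral {0..1} (\<lambda>t. w t *\<^sub>R G (P z + t *\<^sub>R R z)))"
  using assms by (simp add: smooth_on_def Cn_on_param_integral)

section \<open>Taylor's formula on a segment and symmetry of second derivatives\<close>

lemma has_vector_derivative_along_line:
  assumes "smooth_on UNIV f"
  shows "((\<lambda>t. f (p + t *\<^sub>R r)) has_vector_derivative dirderiv r f (p + t *\<^sub>R r)) (at t within T)"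
proof -
  have "((\<lambda>t. f (p + t *\<^sub>R r)) has_derivative (\<lambda>s. dirderiv (s *\<^sub>R r) f (p + t *\<^sub>R r))) (at t within T)"
    by (rule has_derivative_compose[OF _ smooth_on_UNIV_has_derivative[OF assms]])
      (auto intro!: derivative_eq_intros)
  then show ?thesis
    by (simp add: has_vector_derivative_def dirderiv_scaleR[OF assms])
qed

lemma smooth_on_dirderiv_funpow: "smooth_on S f \<Longrightarrow> smooth_on S ((dirderiv r ^^ m) f)"
  by (induction m) (auto intro: smooth_on_dirderiv)

lemma taylor_dirderiv:
  fixes f :: "'a::euclidean_space \<Rightarrow> real"
  assumes f: "smooth_on UNIV f"
  shows "f (p + r) = (\<Sum>m<Suc n. (dirderiv r ^^ m) f p / fact m)
    + integral {0..1} (\<lambda>t. ((1 - t) ^ n / fact n) * (dirderiv r ^^ Suc n) f (p + t *\<^sub>R r))"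
proof -
  have "((\<lambda>t. ((1 - t) ^ (Suc n - 1) / fact (Suc n - 1)) *\<^sub>R (dirderiv r ^^ Suc n) f (p + t *\<^sub>R r)) has_integral
    f (p + 1 *\<^sub>R r) - (\<Sum>m<Suc n. ((1 - 0) ^ m / fact m) *\<^sub>R (dirderiv r ^^ m) f (p + 0 *\<^sub>R r))) {0..1::real}"
    by (rule Taylor_has_integral[where Df="\<lambda>m t. (dirderiv r ^^ m) f (p + t *\<^sub>R r)"])
      (auto intro!: has_vector_derivative_along_line smooth_on_dirderiv_funpow f)
  then have "((\<lambda>t. ((1 - t) ^ n / fact n) * (dirderiv r ^^ Suc n) f (p + t *\<^sub>R r)) has_integral
    f (p + r) - (\<Sum>m<Suc n. (dirderiv r ^^ m) f p / fact m)) {0..1::real}"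
    by (simp del: sum.lessThan_Suc)
  from integral_unique[OF this] show ?thesis by (simp del: sum.lessThan_Suc)
qed

text \<open>Write \<open>f (x + s u)\<close> as \<open>f x\<close> plus \<open>s\<close> times the
  integral of the \<open>u\<close>-derivative over the segment, and differentiate this in direction
  \<open>v\<close> under the integral sign. Then \<open>dirderiv v f (x + s u)\<close> is
  \<open>dirderiv v f x\<close> plus \<open>s\<close> times a function \<open>?I\<close> continuous
  in \<open>s\<close>, whose value at 0 is therefore the derivative in \<open>s\<close>.\<close>

theorem dirderiv_commute:
  fixes f :: "'a::euclidean_space \<Rightarrow> real"
  assumes f: "smooth_on UNIV f"
  shows "dirderiv u (dirderiv v f) x = dirderiv v (dirderiv u f) x"
proof -
  let ?I = "\<lambda>s. integral {0..1} (\<lambda>t. dirderiv v (dirderiv u f) ((t * s) *\<^sub>R u + x))"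
  have du: "smooth_on UNIV (dirderiv u f)" and dv: "smooth_on UNIV (dirderiv v f)"
    and dvu: "smooth_on UNIV (dirderiv v (dirderiv u f))"
    by (intro smooth_on_dirderiv f)+
  have eq: "dirderiv v f (x + s *\<^sub>R u) = dirderiv v f x + s * ?I s" for s
  proof -
    have shift: "f (x + s *\<^sub>R u) = f x + s * integral {0..1} (\<lambda>t. dirderiv u f ((t * s) *\<^sub>R u + x))" for x
      using taylor_dirderiv[OF f, of x "s *\<^sub>R u" 0]
      by (simp add: dirderiv_scaleR[OF f] algebra_simps)
    have "((\<lambda>x. f x + s * integral {0..1} (\<lambda>t. 1 *\<^sub>R dirderiv u f ((t * s) *\<^sub>R u + x + t *\<^sub>R 0))) has_derivative
        (\<lambda>v. dirderiv v f x + s * integral {0..1} (\<lambda>t. 1 *\<^sub>R dirderiv (v + t *\<^sub>R 0) (dirderiv u f) ((t * s) *\<^sub>R u + x + t *\<^sub>R 0)))) (at x)"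
      by (intro has_derivative_add smooth_on_UNIV_has_derivative f has_derivative_mult_right
          has_derivative_param_integral smooth_onD du continuous_intros bounded_linear_ident bounded_linear_zero)
    then have 1: "((\<lambda>x. f (x + s *\<^sub>R u)) has_derivative
        (\<lambda>v. dirderiv v f x + s * integral {0..1} (\<lambda>t. dirderiv v (dirderiv u f) ((t * s) *\<^sub>R u + x)))) (at x)"
      by (simp add: shift)
    have "((\<lambda>x. f (x + s *\<^sub>R u)) has_derivative (\<lambda>v. dirderiv v f (x + s *\<^sub>R u))) (at x)"
      by (rule has_derivative_compose[OF _ smooth_on_UNIV_has_derivative[OF f]])
        (auto intro!: derivative_eq_intros)
    from has_derivative_unique[OF this 1] show ?thesis by (rule fun_cong)
  qed
  have "continuous_on UNIV (\<lambda>s. integral (cbox 0 1) (\<lambda>t. dirderiv v (dirderiv u f) ((t * s) *\<^sub>R u + x)))"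
    by (rule integral_continuous_on_param, unfold split_def)
      (intro continuous_on_compose2[OF smooth_on_imp_continuous_on[OF dvu]] continuous_intros, auto)
  then have "isCont ?I 0"
    by (simp add: continuous_on_eq_continuous_at)
  from has_derivative_scaleR_vanishing[OF this has_derivative_ident]
  have "((\<lambda>s. ?I s *\<^sub>R s) has_derivative (\<lambda>h. ?I 0 *\<^sub>R h)) (at 0)" by simp
  then have "((\<lambda>s. dirderiv v f x + ?I s *\<^sub>R s) has_derivative (\<lambda>h. 0 + ?I 0 *\<^sub>R h)) (at 0)"
    by (intro has_derivative_add has_derivative_const)
  then have 1: "((\<lambda>s. dirderiv v f (x + s *\<^sub>R u)) has_derivative (\<lambda>h. h * dirderiv v (dirderiv u f) x)) (at 0)"
    by (simp add: eq mult.commute)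
  have "((\<lambda>s. dirderiv v f (x + s *\<^sub>R u)) has_derivative (\<lambda>h. h * dirderiv u (dirderiv v f) x)) (at 0)"
    using has_vector_derivative_along_line[OF dv, of x u 0] by (simp add: has_vector_derivative_def)
  from has_derivative_unique[OF this 1] show ?thesis by (metis mult_1)
qed

lemma dirderiv_square_plane:
  fixes f :: "'a::euclidean_space \<Rightarrow> real"
  assumes f: "smooth_on UNIV f"
  shows "(dirderiv (a *\<^sub>R u + b *\<^sub>R v) ^^ 2) f = (\<lambda>z. a\<^sup>2 * dirderiv u (dirderiv u f) z
    + 2 * a * b * dirderiv u (dirderiv v f) z + b\<^sup>2 * dirderiv v (dirderiv v f) z)"
proof -
  let ?w = "a *\<^sub>R u + b *\<^sub>R v"
  have w: "dirderiv ?w g = (\<lambda>z. a * dirderiv u g z + b * dirderiv v g z)" if "smooth_on UNIV g" for g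
    by (simp add: fun_eq_iff dirderiv_add[OF that] dirderiv_scaleR[OF that])
  note d = smooth_on_dirderiv
  have "(dirderiv ?w ^^ 2) f = dirderiv ?w (dirderiv ?w f)" by (simp add: numeral_2_eq_2)
  also have "\<dots> = (\<lambda>z. a * dirderiv ?w (dirderiv u f) z + b * dirderiv ?w (dirderiv v f) z)"
    by (simp add: w[OF f] dirderiv_linear_combination[OF d[OF f] d[OF f]])
  finally show ?thesis
    by (simp add: w[OF d[OF f]] fun_eq_iff dirderiv_commute[OF f, of v u]) (simp add: power2_eq_square algebra_simps)
qed

lemma dirderiv_cube_plane:
  fixes f :: "'a::euclidean_space \<Rightarrow> real"
  assumes f: "smooth_on UNIV f"
  shows "(dirderiv (a *\<^sub>R u + b *\<^sub>R v) ^^ 3) f z = a^3 * dirderiv u (dirderiv u (dirderiv u f)) z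
    + 3 * a\<^sup>2 * b * dirderiv u (dirderiv u (dirderiv v f)) z
    + 3 * a * b\<^sup>2 * dirderiv u (dirderiv v (dirderiv v f)) z + b^3 * dirderiv v (dirderiv v (dirderiv v f)) z"
proof -
  let ?w = "a *\<^sub>R u + b *\<^sub>R v"
  note d = smooth_on_dirderiv
  have w: "dirderiv ?w f = (\<lambda>z. a * dirderiv u f z + b * dirderiv v f z)"
    by (simp add: fun_eq_iff dirderiv_add[OF f] dirderiv_scaleR[OF f])
  have c: "dirderiv v (dirderiv u g) = dirderiv u (dirderiv v g)" if "smooth_on UNIV g" for g :: "'a \<Rightarrow> real"
    using dirderiv_commute[OF that] by blast
  have sq: "smooth_on UNIV (dirderiv x (dirderiv y f))" for x y by (intro d f)
  have "(dirderiv ?w ^^ 3) f z = (dirderiv ?w ^^ 2) (dirderiv ?w f) z"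
    by (simp add: numeral_3_eq_3 numeral_2_eq_2)
  also have "\<dots> = a * (dirderiv ?w ^^ 2) (dirderiv u f) z + b * (dirderiv ?w ^^ 2) (dirderiv v f) z"
    unfolding w numeral_2_eq_2 funpow.simps o_apply id_apply
    by (simp add: dirderiv_linear_combination d f)
  finally show ?thesis
    unfolding dirderiv_square_plane[OF d[OF f]]
    by (simp add: c[OF f] c[OF d[OF f]]) (simp add: power2_eq_square power3_eq_cube algebra_simps)
qed

subsection \<open>Binary cubic forms\<close>

definition cubic :: "real \<times> real \<times> real \<times> real \<Rightarrow> real \<Rightarrow> real \<Rightarrow> real" where
  "cubic = (\<lambda>(A, B, C, D) x y. A * x^3 + B * x\<^sup>2 * y + C * x * y\<^sup>2 + D * y^3)"

text \<open>The negative of the classical discriminant of a binary cubic: it is positive when there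
  is a single real linear factor and negative when there are three distinct ones.\<close>

definition cubic_disc :: "real \<times> real \<times> real \<times> real \<Rightarrow> real" where
  "cubic_disc = (\<lambda>(A, B, C, D).
     4 * (B^3 * D + A * C^3) + 27 * A\<^sup>2 * D\<^sup>2 - B\<^sup>2 * C\<^sup>2 - 18 * A * B * C * D)"

text \<open>The tuple \<open>(a, b, c, d)\<close> stands for the substitution \<open>(x, y) \<mapsto> (a x + b y, c x + d y)\<close>.\<close>

definition cubic_subst ::
    "real \<times> real \<times> real \<times> real \<Rightarrow> real \<times> real \<times> real \<times> real \<Rightarrow> real \<times> real \<times> real \<times> real" where
  "cubic_subst = (\<lambda>(a, b, c, d) (A, B, C, D).
     (A * a^3 + B * a\<^sup>2 * c + C * a * c\<^sup>2 + D * c^3,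
      3 * A * a\<^sup>2 * b + B * (a\<^sup>2 * d + 2 * a * b * c) + C * (2 * a * c * d + b * c\<^sup>2) + 3 * D * c\<^sup>2 * d,
      3 * A * a * b\<^sup>2 + B * (2 * a * b * d + b\<^sup>2 * c) + C * (a * d\<^sup>2 + 2 * b * c * d) + 3 * D * c * d\<^sup>2,
      A * b^3 + B * b\<^sup>2 * d + C * b * d\<^sup>2 + D * d^3))"

lemma cubic_cubic_subst:
  "cubic (cubic_subst (a, b, c, d) k) x y = cubic k (a * x + b * y) (c * x + d * y)"
  by (cases k) (simp add: cubic_def cubic_subst_def power2_eq_square power3_eq_cube algebra_simps)

lemma cubic_eqD:
  assumes "\<And>x y. cubic k x y = cubic l x y"
  shows "k = l"
proof -
  obtain A B C D A' B' C' D' where "k = (A, B, C, D)" "l = (A', B', C', D')"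
    by (metis prod_cases4)
  then show ?thesis
    using assms[of 1 0] assms[of 0 1] assms[of 1 1] assms[of 1 "-1"] by (simp add: cubic_def)
qed

text \<open>The Hessian \<open>(P, Q, R)\<close> of a cubic is a quadratic covariant with \<open>Q\<^sup>2 - 4 P R = 3 \<Delta>\<close>, which
  reduces the invariance of \<open>\<Delta>\<close> to that of a discriminant of degree two.\<close>

lemma cubic_disc_cubic_subst:
  "cubic_disc (cubic_subst (a, b, c, d) k) = (a * d - b * c)^6 * cubic_disc k"
proof -
  obtain A B C D where k: "k = (A, B, C, D)" by (metis prod_cases4)
  obtain A' B' C' D' where k': "cubic_subst (a, b, c, d) k = (A', B', C', D')" by (metis prod_cases4)
  define w where "w = a * d - b * c"
  define P Q R where "P = B\<^sup>2 - 3 * A * C" and "Q = B * C - 9 * A * D" and "R = C\<^sup>2 - 3 * B * D"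
  have A': "A' = A * a^3 + B * a\<^sup>2 * c + C * a * c\<^sup>2 + D * c^3"
    and B': "B' = 3 * A * a\<^sup>2 * b + B * (a\<^sup>2 * d + 2 * a * b * c) + C * (2 * a * c * d + b * c\<^sup>2) + 3 * D * c\<^sup>2 * d"
    and C': "C' = 3 * A * a * b\<^sup>2 + B * (2 * a * b * d + b\<^sup>2 * c) + C * (a * d\<^sup>2 + 2 * b * c * d) + 3 * D * c * d\<^sup>2"
    and D': "D' = A * b^3 + B * b\<^sup>2 * d + C * b * d\<^sup>2 + D * d^3"
    using k' by (simp_all add: k cubic_subst_def)
  note defs = A' B' C' D' P_def Q_def R_def w_def
  have P': "B'\<^sup>2 - 3 * A' * C' = w\<^sup>2 * (P * a\<^sup>2 + Q * a * c + R * c\<^sup>2)"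
    unfolding defs by algebra
  have Q': "B' * C' - 9 * A' * D' = w\<^sup>2 * (2 * P * a * b + Q * (a * d + b * c) + 2 * R * c * d)"
    unfolding defs by algebra
  have R': "C'\<^sup>2 - 3 * B' * D' = w\<^sup>2 * (P * b\<^sup>2 + Q * b * d + R * d\<^sup>2)"
    unfolding defs by algebra
  have disc: "3 * cubic_disc (A, B, C, D) = (B * C - 9 * A * D)\<^sup>2 - 4 * (B\<^sup>2 - 3 * A * C) * (C\<^sup>2 - 3 * B * D)"
    for A B C D
    by (simp add: cubic_disc_def power2_eq_square power3_eq_cube algebra_simps)
  have "3 * cubic_disc (A', B', C', D')
    = (w\<^sup>2)\<^sup>2 * ((2 * P * a * b + Q * (a * d + b * c) + 2 * R * c * d)\<^sup>2
        - 4 * (P * a\<^sup>2 + Q * a * c + R * c\<^sup>2) * (P * b\<^sup>2 + Q * b * d + R * d\<^sup>2))"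
    unfolding disc P' Q' R' by algebra
  \<comment> \<open>The discriminant of a binary quadratic form is multiplied by the squared
    determinant. Together with the factor of degree four in \<open>w\<close> that the Hessian has
    already contributed, this makes the sixth power.\<close>
  also have "(2 * P * a * b + Q * (a * d + b * c) + 2 * R * c * d)\<^sup>2
        - 4 * (P * a\<^sup>2 + Q * a * c + R * c\<^sup>2) * (P * b\<^sup>2 + Q * b * d + R * d\<^sup>2) = w\<^sup>2 * (Q\<^sup>2 - 4 * P * R)"
    by (simp add: w_def power2_eq_square algebra_simps)
  also have "Q\<^sup>2 - 4 * P * R = 3 * cubic_disc k"
    by (simp add: k disc P_def Q_def R_def)
  finally show ?thesis
    by (simp add: k' w_def flip: power_mult power_add)
qed

lemma real_cubic_root:
  fixes A B C D :: real
  assumes "A \<noteq> 0"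
  shows "\<exists>p. A * p^3 + B * p\<^sup>2 + C * p + D = 0"
proof -
  let ?f = "\<lambda>p. A * p^3 + B * p\<^sup>2 + C * p + D"
  define s where "s = \<bar>B\<bar> + \<bar>C\<bar> + \<bar>D\<bar>"
  \<comment> \<open>A Cauchy type bound: \<open>M \<ge> 1\<close> bounds the lower order terms at
    \<open>\<bar>p\<bar> = M\<close> by \<open>s * M\<^sup>2\<close>, and
    \<open>s < \<bar>A\<bar> * M\<close> lets the leading term dominate, so the values at
    \<open>M\<close> and \<open>-M\<close> have opposite signs.\<close>
  define M where "M = 1 + s / \<bar>A\<bar>"
  have s: "s \<ge> 0" by (simp add: s_def)
  have M1: "M \<ge> 1" using s by (simp add: M_def)
  have sM: "s < \<bar>A\<bar> * M" using assms by (simp add: M_def distrib_left)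
  have bound: "\<bar>B * p\<^sup>2 + C * p + D\<bar> < \<bar>A\<bar> * M^3" if "\<bar>p\<bar> = M" for p
  proof -
    have p2: "p\<^sup>2 = M\<^sup>2" using that by (metis power2_abs)
    have "\<bar>C * p\<bar> \<le> \<bar>C\<bar> * M\<^sup>2"
      using that self_le_power[OF M1, of 2] by (auto simp: abs_mult intro!: mult_left_mono)
    moreover have "\<bar>D\<bar> \<le> \<bar>D\<bar> * M\<^sup>2" using M1 by (simp add: mult_le_cancel_left1)
    moreover have "\<bar>B * p\<^sup>2\<bar> = \<bar>B\<bar> * M\<^sup>2" by (simp add: abs_mult p2)
    ultimately have "\<bar>B * p\<^sup>2 + C * p + D\<bar> \<le> s * M\<^sup>2"
      unfolding s_def distrib_right by linarith
    also have "\<dots> < \<bar>A\<bar> * M * M\<^sup>2" using sM M1 by (intro mult_strict_right_mono) auto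
    finally show ?thesis by (simp add: power2_eq_square power3_eq_cube mult.assoc)
  qed
  have cont: "continuous_on T ?f" for T by (intro continuous_intros)
  have b1: "\<bar>B * M\<^sup>2 + C * M + D\<bar> < \<bar>A\<bar> * M^3" and b2: "\<bar>B * M\<^sup>2 - C * M + D\<bar> < \<bar>A\<bar> * M^3"
    using bound[of M] bound[of "-M"] M1 by auto
  consider "?f (-M) \<le> 0" "0 \<le> ?f M" | "?f M \<le> 0" "0 \<le> ?f (-M)"
  proof (cases "A > 0")
    case True
    then show ?thesis using that(1) b1 b2 by (simp add: abs_less_iff)
  next
    case False
    then have "\<bar>A\<bar> = - A" by simp
    then show ?thesis using that(2) b1 b2 by (simp add: abs_less_iff)
  qed
  then show ?thesis
  proof cases
    case 1 then show ?thesis using IVT'[of ?f "-M" 0 M] cont M1 by auto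
  next
    case 2 then show ?thesis using IVT2'[of ?f M 0 "-M"] cont M1 by auto
  qed
qed

text \<open>A real root direction moved to the first axis makes the cubic divisible by
  \<open>y\<close>; completing the square in the quadratic cofactor and rescaling both variables
  does the rest. The sign hypothesis is what makes the last rescaling real.\<close>

lemma cubic_normal_form:
  assumes "e * cubic_disc k > 0"
  obtains a b c d where "a * d - b * c \<noteq> 0" "cubic_subst (a, b, c, d) k = (0, 1, 0, e)"
proof -
  define NF where "NF k \<longleftrightarrow> (\<exists>a b c d. a * d - b * c \<noteq> 0 \<and>
      (\<forall>x y. cubic k (a * x + b * y) (c * x + d * y) = x\<^sup>2 * y + e * y^3))" for k
  have NF0: "NF (0, b, c, d)" if "e * cubic_disc (0, b, c, d) > 0" for b c d
  proof -
    \<comment> \<open>The coefficient of \<open>y^3\<close> after completing the square in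
      \<open>y * (b * x\<^sup>2 + c * x * y + d * y\<^sup>2)\<close>.\<close>
    define d' where "d' = (4 * b * d - c\<^sup>2) / (4 * b)"
    have disc: "cubic_disc (0, b, c, d) = b\<^sup>2 * (4 * b * d - c\<^sup>2)"
      by (simp add: cubic_disc_def power2_eq_square power3_eq_cube algebra_simps)
    have b: "b \<noteq> 0" using that by (auto simp: disc)
    have "e * cubic_disc (0, b, c, d) = (e * d' * b) * (4 * b\<^sup>2)"
      using b by (simp add: disc d'_def power2_eq_square)
    with that have "(e * d' * b) * (4 * b\<^sup>2) > 0" by (simp only:)
    then have edb: "e * d' * b > 0"
      by (rule zero_less_mult_pos2) (use b in simp)
    then have d': "d' \<noteq> 0" by auto
    \<comment> \<open>The scale \<open>\<beta>\<close> of \<open>y\<close> must satisfy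
      \<open>d' * \<beta>^3 = e\<close>, and the scale \<open>\<alpha>\<close> of \<open>x\<close>
      must satisfy \<open>\<alpha>\<^sup>2 * (b * \<beta>) = 1\<close>. The first is always
      solvable; the second needs \<open>b * \<beta>\<close> positive, which is the sign condition
      \<open>e * d' * b > 0\<close>.\<close>
    define \<beta> where "\<beta> = root 3 (e / d')"
    have \<beta>3: "\<beta>^3 = e / d'" by (simp add: \<beta>_def odd_real_root_pow)
    have "b * (e / d') > 0" using divide_pos_pos[OF edb, of "d'\<^sup>2"] zero_less_power2[of d'] d'
      by (simp add: power2_eq_square mult.commute del: zero_less_power2)
    then have b\<beta>: "b * \<beta> > 0" unfolding \<beta>_def zero_less_mult_iff by simp
    then have \<beta>: "\<beta> \<noteq> 0" by auto
    define \<alpha> where "\<alpha> = 1 / sqrt (b * \<beta>)"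
    have \<alpha>2: "\<alpha>\<^sup>2 * (b * \<beta>) = 1" using b\<beta> \<beta> b by (simp add: \<alpha>_def power_divide)
    then have \<alpha>: "\<alpha> \<noteq> 0" by auto
    have "cubic (0, b, c, d) (\<alpha> * x + - (c * \<beta> / (2 * b)) * y) (0 * x + \<beta> * y) = x\<^sup>2 * y + e * y^3" for x y
    proof -
      have "cubic (0, b, c, d) (\<alpha> * x + - (c * \<beta> / (2 * b)) * y) (0 * x + \<beta> * y)
          = (\<alpha>\<^sup>2 * (b * \<beta>)) * (x\<^sup>2 * y) + d' * \<beta>^3 * y^3"
        using b by (simp add: cubic_def d'_def power2_eq_square power3_eq_cube field_simps)
      then show ?thesis using d' by (simp add: \<alpha>2 \<beta>3)
    qed
    moreover have "\<alpha> * \<beta> - - (c * \<beta> / (2 * b)) * 0 \<noteq> 0" using \<alpha> \<beta> by simp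
    ultimately show ?thesis unfolding NF_def by blast
  qed
  have "NF k"
  proof -
    obtain A B C D where k: "k = (A, B, C, D)" by (metis prod_cases4)
    show ?thesis
    proof (cases "A = 0")
      case True
      then show ?thesis using NF0 assms k by simp
    next
      case False
      then obtain p where p: "A * p^3 + B * p\<^sup>2 + C * p + D = 0" using real_cubic_root by blast
      \<comment> \<open>This substitution sends \<open>(1, 0)\<close> to the root
        \<open>(p, 1)\<close>, which kills the coefficient of \<open>x^3\<close>. Its determinant is
        -1, so the discriminant is unchanged.\<close>
      obtain B' C' D' where k': "cubic_subst (p, 1, 1, 0) k = (0, B', C', D')"
        using p by (auto simp: k cubic_subst_def)
      have "NF (cubic_subst (p, 1, 1, 0) k)"
        unfolding k' by (rule NF0) (use assms in \<open>simp add: k'[symmetric] cubic_disc_cubic_subst\<close>)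
      then obtain a b c d where abcd: "a * d - b * c \<noteq> 0"
        and eq: "\<And>x y. cubic k (p * (a * x + b * y) + 1 * (c * x + d * y)) (1 * (a * x + b * y) + 0 * (c * x + d * y))
          = x\<^sup>2 * y + e * y^3"
        unfolding NF_def cubic_cubic_subst by blast
      have "cubic k ((p * a + c) * x + (p * b + d) * y) (a * x + b * y) = x\<^sup>2 * y + e * y^3" for x y
        using eq[of x y] by (simp add: algebra_simps)
      moreover have "(p * a + c) * b - (p * b + d) * a \<noteq> 0" using abcd by (simp add: algebra_simps)
      ultimately show ?thesis unfolding NF_def by blast
    qed
  qed
  then obtain a b c d where "a * d - b * c \<noteq> 0"
    and eq: "\<And>x y. cubic k (a * x + b * y) (c * x + d * y) = x\<^sup>2 * y + e * y^3"
    unfolding NF_def by blast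
  moreover have "cubic_subst (a, b, c, d) k = (0, 1, 0, e)"
    by (rule cubic_eqD) (simp add: cubic_cubic_subst eq, simp add: cubic_def)
  ultimately show thesis using that by blast
qed

text \<open>A local inverse of the orbit map chooses the substitution smoothly in the cubic. Its
  value at the normal form is the identity, which later makes the derivative of the new coordinates
  computable.\<close>

lemma cubic_orbit_section:
  assumes "e \<noteq> 0"
  obtains W N where "open W" "(0, 1, 0, e) \<in> W" "smooth_on W N" "N (0, 1, 0, e) = (1, 0, 0, 1)"
    "\<And>k. k \<in> W \<Longrightarrow> cubic_subst (N k) (0, 1, 0, e) = k"
proof -
  let ?F = "\<lambda>m. cubic_subst m (0, 1, 0, e)"
  have F: "?F = (\<lambda>m. let a = fst m; b = fst (snd m); c = fst (snd (snd m)); d = snd (snd (snd m)) in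
     (a\<^sup>2 * c + e * c^3, a\<^sup>2 * d + 2 * a * b * c + 3 * e * c\<^sup>2 * d,
      2 * a * b * d + b\<^sup>2 * c + 3 * e * c * d\<^sup>2, b\<^sup>2 * d + e * d^3))"
    by (auto simp: fun_eq_iff cubic_subst_def Let_def)
  have smooth: "smooth_on UNIV ?F"
    unfolding F Let_def by (intro smooth_intros open_UNIV)
  have "(?F has_derivative (\<lambda>h. (fst (snd (snd h)), 2 * fst h + snd (snd (snd h)),
      2 * fst (snd h) + 3 * e * fst (snd (snd h)), 3 * e * snd (snd (snd h))))) (at (1, 0, 0, 1))"
    unfolding F Let_def by (auto intro!: derivative_eq_intros)
  from dirderiv_eqI[OF this]
  \<comment> \<open>For \<open>h = (a, b, c, d)\<close> the derivative is
    \<open>(c, 2 * a + d, 2 * b + 3 * e * c, 3 * e * d)\<close>; it vanishes only at 0 because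
    \<open>e \<noteq> 0\<close> forces \<open>d = 0\<close>.\<close>
  have inj: "h = 0" if "dirderiv h ?F (1, 0, 0, 1) = 0" for h
    using that assms by (cases h) (auto simp: zero_prod_def)
  obtain U g where U: "open U" "(1, 0, 0, 1) \<in> U" "open (?F ` U)" "smooth_on (?F ` U) g"
    "\<And>x. x \<in> U \<Longrightarrow> g (?F x) = x"
    by (rule smooth_inverse_function[OF open_UNIV smooth UNIV_I inj]) auto
  have F1: "?F (1, 0, 0, 1) = (0, 1, 0, e)" by (simp add: cubic_subst_def)
  show thesis
  proof (rule that[OF U(3) _ U(4)])
    show "(0, 1, 0, e) \<in> ?F ` U" using U(2) F1 by (metis image_eqI)
    show "g (0, 1, 0, e) = (1, 0, 0, 1)" using U(5)[OF U(2)] F1 by simp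
    show "cubic_subst (g k) (0, 1, 0, e) = k" if "k \<in> ?F ` U" for k
      using that U(5) by auto
  qed
qed

subsection \<open>Smooth families of symmetric matrices\<close>

lemma bounded_bilinear_matrix_matrix_mult:
  "bounded_bilinear ((**) :: real^'n^'m \<Rightarrow> real^'p^'n \<Rightarrow> real^'p^'m)"
  by (simp add: bilinear_conv_bounded_bilinear[symmetric] bilinear_def)
    (auto intro!: linearI simp: vec_eq_iff matrix_matrix_mult_def sum.distrib sum_distrib_left algebra_simps)

lemma bounded_bilinear_matrix_vector_mult:
  "bounded_bilinear ((*v) :: real^'n^'m \<Rightarrow> real^'n \<Rightarrow> real^'m)"
  by (simp add: bilinear_conv_bounded_bilinear[symmetric] bilinear_def)
    (auto intro!: linearI simp: vec_eq_iff matrix_vector_mult_def sum.distrib sum_distrib_left algebra_simps)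

text \<open>Squaring has derivative \<open>2 H\<close> at the identity, hence is locally invertible
  there. The set \<open>U\<close> is supplied too, because \<open>T (X ** X) = X\<close> on it
  expresses uniqueness of the root near the identity.\<close>

lemma matrix_sqrt:
  obtains W U and T :: "real^'n::finite^'n \<Rightarrow> real^'n^'n"
  where "open W" "mat 1 \<in> W" "open U" "mat 1 \<in> U" "smooth_on W T" "T (mat 1) = mat 1"
    "\<And>B. B \<in> W \<Longrightarrow> T B ** T B = B" "\<And>X. X \<in> U \<Longrightarrow> T (X ** X) = X"
proof -
  let ?F = "\<lambda>X :: real^'n^'n. X ** X"
  have smooth: "smooth_on UNIV ?F"
    by (intro smooth_on_bilinear[OF open_UNIV bounded_bilinear_matrix_matrix_mult] smooth_intros open_UNIV)
  have "(?F has_derivative (\<lambda>H. mat 1 ** H + H ** mat 1)) (at (mat 1))"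
    by (intro bounded_bilinear.FDERIV[OF bounded_bilinear_matrix_matrix_mult] has_derivative_ident)
  note * = dirderiv_eqI[OF this]
  have inj: "H = 0" if "dirderiv H ?F (mat 1) = 0" for H
    using that unfolding * by (simp add: vec_eq_iff)
  obtain U g where U: "open U" "mat 1 \<in> U" "open (?F ` U)" "smooth_on (?F ` U) g"
    "\<And>x. x \<in> U \<Longrightarrow> g (?F x) = x"
    by (rule smooth_inverse_function[OF open_UNIV smooth UNIV_I inj]) auto
  show thesis
  proof (rule that[OF U(3) _ U(1,2,4)])
    show "mat 1 \<in> ?F ` U" using image_eqI[OF _ U(2), of "mat 1" ?F] by simp
    show "g (mat 1) = mat 1" using U(5)[OF U(2)] by simp
    show "g B ** g B = B" if "B \<in> ?F ` U" for B using that U(5) by auto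
  qed (rule U(5))
qed

text \<open>With \<open>X = sqrt (q(0)\<^sup>-\<^sup>1 q(z))\<close>, uniqueness of the square root near the identity gives
  \<open>q(0) X = X\<^sup>T q(0)\<close>, so \<open>X\<^sup>T q(0) X = q(0) X\<^sup>2 = q(z)\<close>; it also makes \<open>X\<close> commute with every
  involution commuting with \<open>q\<close>.\<close>

lemma smooth_congruence_of_symmetric_matrices:
  fixes q :: "'a::real_normed_vector \<Rightarrow> real^'n::finite^'n"
  assumes V: "open V" "0 \<in> V" and q: "smooth_on V q" and sym: "\<And>z. z \<in> V \<Longrightarrow> transpose (q z) = q z"
    and inv: "invertible (q 0)"
    and J: "J ** J = mat 1" and qJ: "\<And>z. z \<in> V \<Longrightarrow> J ** q z = q z ** J"
  obtains V' X where "open V'" "0 \<in> V'" "V' \<subseteq> V" "smooth_on V' X" "X 0 = mat 1"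
    "\<And>z. z \<in> V' \<Longrightarrow> transpose (X z) ** q 0 ** X z = q z"
    "\<And>z. z \<in> V' \<Longrightarrow> J ** X z = X z ** J"
proof -
  obtain p where p: "p ** q 0 = mat 1" "q 0 ** p = mat 1"
    using inv by (auto simp: invertible_def)
  obtain W U and T :: "real^'n^'n \<Rightarrow> real^'n^'n" where T: "open W" "mat 1 \<in> W" "open U" "mat 1 \<in> U"
    "smooth_on W T" "T (mat 1) = mat 1" "\<And>B. B \<in> W \<Longrightarrow> T B ** T B = B" "\<And>X. X \<in> U \<Longrightarrow> T (X ** X) = X"
  proof (rule matrix_sqrt)
  qed (rule that)
  note assoc = matrix_mul_assoc
  define B where "B z = p ** q z" for z
  have Bs: "smooth_on V B"
    unfolding B_def
    by (intro smooth_on_bilinear[OF V(1) bounded_bilinear_matrix_matrix_mult] q smooth_on_const)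
  define V1 where "V1 = V \<inter> B -` W"
  have V1: "open V1" "0 \<in> V1" "V1 \<subseteq> V"
    using continuous_open_preimage[OF smooth_on_imp_continuous_on[OF Bs] V(1) T(1)] V(2) T(2)
    by (auto simp: V1_def B_def p)
  define X where "X z = T (B z)" for z
  have Xs: "smooth_on V1 X"
    unfolding X_def
    by (rule smooth_on_compose[OF V1(1) T(1) smooth_on_subset[OF Bs V1(3)] T(5)]) (simp add: V1_def)
  have X0: "X 0 = mat 1" by (simp add: X_def B_def p T(6))
  have XX: "X z ** X z = p ** q z" if "z \<in> V1" for z
    using T(7)[of "B z"] that by (simp add: X_def V1_def B_def)
  \<comment> \<open>\<open>Y z\<close> is the adjoint of \<open>X z\<close> with respect to the form
    \<open>q 0\<close>, and \<open>Z z\<close> is the conjugate of \<open>X z\<close> by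
    \<open>J\<close>. Both equal the identity at 0 and, as shown below, have the same square as
    \<open>X z\<close>.\<close>
  define Y where "Y z = p ** (transpose (X z) ** q 0)" for z
  define Z where "Z z = J ** (X z ** J)" for z
  have "bounded_linear (transpose :: real^'n^'n \<Rightarrow> real^'n^'n)"
    by (simp add: linear_conv_bounded_linear[symmetric])
      (auto intro!: linearI simp: transpose_def vec_eq_iff)
  then have Ys: "smooth_on V1 Y"
    unfolding Y_def
    by (intro smooth_on_bilinear[OF V1(1) bounded_bilinear_matrix_matrix_mult] smooth_on_const
        smooth_on_bounded_linear[OF V1(1) _ Xs])
  have Zs: "smooth_on V1 Z"
    unfolding Z_def
    by (intro smooth_on_bilinear[OF V1(1) bounded_bilinear_matrix_matrix_mult] smooth_on_const Xs)
  \<comment> \<open>Near 0 both competitors lie in the region where the square root is unique, so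
    they coincide with \<open>X z\<close>.\<close>
  define V' where "V' = (V1 \<inter> Y -` U) \<inter> (V1 \<inter> Z -` U)"
  have V': "open V'" "0 \<in> V'" "V' \<subseteq> V1"
    using continuous_open_preimage[OF smooth_on_imp_continuous_on[OF Ys] V1(1) T(3)]
      continuous_open_preimage[OF smooth_on_imp_continuous_on[OF Zs] V1(1) T(3)] V1(2) T(4)
    by (auto simp: V'_def Y_def Z_def X0 p transpose_mat J)
  have uniq: "M = X z" if "M \<in> U" "M ** M = X z ** X z" "z \<in> V1" for M z
    using T(8)[OF that(1)] that(2) XX[OF that(3)] by (simp add: X_def B_def)
  have YY: "Y z ** Y z = X z ** X z" if z: "z \<in> V1" for z
  proof -
    have tp: "transpose p ** q 0 = mat 1"
      using arg_cong[OF p(2), of transpose] sym[OF V(2)] by (simp add: matrix_transpose_mul transpose_mat)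
    have "Y z ** Y z = p ** transpose (X z) ** (q 0 ** p) ** transpose (X z) ** q 0"
      by (simp add: Y_def assoc)
    also have "\<dots> = p ** transpose (X z ** X z) ** q 0"
      by (simp add: p matrix_transpose_mul assoc)
    also have "\<dots> = p ** (q z ** (transpose p ** q 0))"
      using sym[of z] z V1(3) by (simp add: XX[OF z] matrix_transpose_mul assoc subset_iff)
    finally show ?thesis by (simp add: tp XX[OF z])
  qed
  have ZZ: "Z z ** Z z = X z ** X z" if z: "z \<in> V1" for z
  proof -
    have "J ** p = (p ** q 0) ** (J ** p)" by (simp add: p)
    also have "\<dots> = p ** (J ** q 0) ** p" by (simp add: qJ[OF V(2)] assoc)
    also have "\<dots> = p ** J ** (q 0 ** p)" by (simp add: assoc)
    finally have Jp: "J ** p = p ** J" by (simp add: p)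
    have "Z z ** Z z = J ** X z ** (J ** J) ** X z ** J" by (simp add: Z_def assoc)
    also have "\<dots> = J ** (X z ** X z) ** J" by (simp add: J assoc)
    also have "\<dots> = (J ** p) ** q z ** J" by (simp add: XX[OF z] assoc)
    also have "\<dots> = p ** (J ** q z) ** J" by (simp add: Jp assoc)
    also have "\<dots> = p ** q z ** (J ** J)" using qJ[of z] z V1(3) by (simp add: assoc subset_iff)
    finally show ?thesis by (simp add: J XX[OF z])
  qed
  show thesis
  proof (rule that[OF V'(1,2)])
    show "V' \<subseteq> V" using V'(3) V1(3) by simp
    show "smooth_on V' X" by (rule smooth_on_subset[OF Xs V'(3)])
    show "X 0 = mat 1" by (rule X0)
    fix z assume z: "z \<in> V'"
    then have zV1: "z \<in> V1" using V'(3) by auto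
    have "Y z = X z" by (rule uniq[OF _ YY[OF zV1] zV1]) (use z in \<open>simp add: V'_def\<close>)
    then have "q 0 ** p ** (transpose (X z) ** q 0) = q 0 ** X z"
      by (metis Y_def assoc)
    then have "transpose (X z) ** q 0 ** X z = q 0 ** (X z ** X z)"
      by (simp add: p assoc)
    also have "\<dots> = (q 0 ** p) ** q z" by (simp add: XX[OF zV1] assoc)
    finally show "transpose (X z) ** q 0 ** X z = q z" by (simp add: p)
    have "Z z = X z" by (rule uniq[OF _ ZZ[OF zV1] zV1]) (use z in \<open>simp add: V'_def\<close>)
    then have "J ** Z z = J ** X z" by simp
    moreover have "J ** Z z = (J ** J) ** (X z ** J)" by (simp add: Z_def assoc)
    ultimately show "J ** X z = X z ** J" by (simp add: J)
  qed
qed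

subsection \<open>Taylor decomposition along the kernel of the second differential\<close>

text \<open>The splitting stays inside the full space, with the missing coordinates zero, so that
  all vectors and matrices keep one type.\<close>

definition plane_part :: "'n::finite \<Rightarrow> 'n \<Rightarrow> real^'n \<Rightarrow> real^'n" where
  "plane_part i j z = z $ i *\<^sub>R axis i 1 + z $ j *\<^sub>R axis j 1"

definition rest_part :: "'n::finite \<Rightarrow> 'n \<Rightarrow> real^'n \<Rightarrow> real^'n" where
  "rest_part i j z = z - plane_part i j z"

lemma bounded_linear_plane_part: "bounded_linear (plane_part i j)"
  unfolding plane_part_def
  by (intro bounded_linear_add bounded_linear_scaleR_const bounded_linear_vec_nth)

lemma bounded_linear_rest_part: "bounded_linear (rest_part i j)"
  unfolding rest_part_def[abs_def]
  by (intro bounded_linear_sub bounded_linear_ident bounded_linear_plane_part)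

lemma plane_part_nth:
  "i \<noteq> j \<Longrightarrow> plane_part i j z $ l = (if l \<in> {i, j} then z $ l else 0)"
  by (auto simp: plane_part_def axis_def)

lemma rest_part_nth:
  "i \<noteq> j \<Longrightarrow> rest_part i j z $ l = (if l \<in> {i, j} then 0 else z $ l)"
  by (simp add: rest_part_def plane_part_nth)

lemma plane_part_add_rest_part: "plane_part i j z + rest_part i j z = z"
  by (simp add: rest_part_def)

lemma dirderiv_eq_sum_axis:
  fixes g :: "real^'n::finite \<Rightarrow> real"
  assumes "smooth_on UNIV g"
  shows "dirderiv v g x = (\<Sum>l\<in>UNIV. v $ l * dirderiv (axis l 1) g x)"
proof -
  have "dirderiv v g x = dirderiv (\<Sum>l\<in>UNIV. v $ l *\<^sub>R axis l 1) g x"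
    using basis_expansion[of v] by (simp add: scalar_mult_eq_scaleR)
  then show ?thesis by (simp add: dirderiv_sum[OF assms] dirderiv_scaleR[OF assms])
qed

lemma dirderiv_square_eq_sum_axis:
  fixes g :: "real^'n::finite \<Rightarrow> real"
  assumes g: "smooth_on UNIV g"
  shows "(dirderiv v ^^ 2) g x
    = (\<Sum>l\<in>UNIV. \<Sum>m\<in>UNIV. v $ l * v $ m * dirderiv (axis m 1) (dirderiv (axis l 1) g) x)"
proof -
  have "dirderiv v g = (\<lambda>x. \<Sum>l\<in>UNIV. v $ l * dirderiv (axis l 1) g x)"
    using dirderiv_eq_sum_axis[OF g] by blast
  then have "(dirderiv v ^^ 2) g x = (\<Sum>l\<in>UNIV. v $ l * dirderiv v (dirderiv (axis l 1) g) x)"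
    by (simp add: numeral_2_eq_2 dirderiv_sum_functions smooth_on_dirderiv[OF g])
  also have "\<dots> = (\<Sum>l\<in>UNIV. v $ l * (\<Sum>m\<in>UNIV. v $ m * dirderiv (axis m 1) (dirderiv (axis l 1) g) x))"
    by (subst dirderiv_eq_sum_axis[OF smooth_on_dirderiv[OF g]]) simp
  finally show ?thesis by (simp add: sum_distrib_left mult.assoc)
qed

lemma has_integral_along_segment:
  fixes G :: "'a::euclidean_space \<Rightarrow> real"
  assumes "smooth_on UNIV G" "continuous_on {0..1} w"
  shows "((\<lambda>t. w t * G (p + t *\<^sub>R r)) has_integral integral {0..1} (\<lambda>t. w t * G (p + t *\<^sub>R r))) {0..1}"
proof (intro integrable_integral integrable_continuous_real continuous_on_mult assms(2))
  show "continuous_on {0..1} (\<lambda>t. G (p + t *\<^sub>R r))"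
    by (rule continuous_on_compose2[OF smooth_on_imp_continuous_on[OF assms(1)]])
      (auto intro!: continuous_on_add continuous_on_scaleR continuous_on_const continuous_on_id)
qed

lemma smooth_on_param_integral_real:
  fixes G :: "'a::euclidean_space \<Rightarrow> real" and P R :: "'a \<Rightarrow> 'a"
  assumes "bounded_linear P" "bounded_linear R" "smooth_on UNIV G" "continuous_on {0..1} w"
  shows "smooth_on UNIV (\<lambda>z. integral {0..1} (\<lambda>t. w t * G (P z + t *\<^sub>R R z)))"
  using smooth_on_param_integral[OF assms] by simp

lemma integral_power_1_minus: "integral {0..1} (\<lambda>t::real. (1 - t) ^ n) = 1 / (n + 1)"
proof -
  have "((\<lambda>t. (1 - t) ^ n) has_integral (- ((1 - 1) ^ Suc n / (n + 1)) - - ((1 - 0) ^ Suc n / (n + 1)))) {0..1::real}"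
    by (rule fundamental_theorem_of_calculus)
      (auto intro!: derivative_eq_intros simp: has_real_derivative_iff_has_vector_derivative[symmetric]
        simp del: power_Suc)
  then show ?thesis by (simp add: integral_unique)
qed

text \<open>Meant for the first partial derivatives of \<open>f\<close> along the kernel plane,
  where value and first order term vanish. The summand 0 in \<open>I\<close> gives the integrals the
  shape to which smooth dependence on \<open>z\<close> applies.\<close>

lemma taylor_square_plane:
  fixes g :: "real^'n::finite \<Rightarrow> real"
  assumes g: "smooth_on UNIV g" and g0: "g 0 = 0" "dirderiv (plane_part i j z) g 0 = 0"
  defines "I u v \<equiv> integral {0..1} (\<lambda>t. (1 - t) * dirderiv (axis u 1) (dirderiv (axis v 1) g) (0 + t *\<^sub>R plane_part i j z))"
  shows "g (plane_part i j z) = (z $ i)\<^sup>2 * I i i + z $ i * z $ j * (2 * I i j) + (z $ j)\<^sup>2 * I j j"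
proof -
  let ?p = "plane_part i j z"
  let ?d = "\<lambda>u v t. dirderiv (axis u 1) (dirderiv (axis v 1) g) (0 + t *\<^sub>R ?p)"
  have I: "((\<lambda>t. (1 - t) * ?d u v t) has_integral I u v) {0..1}" for u v
    unfolding I_def
    by (rule has_integral_along_segment) (intro smooth_on_dirderiv g continuous_intros)+
  have "g (0 + ?p) = integral {0..1} (\<lambda>t. (1 - t) * (dirderiv ?p ^^ 2) g (0 + t *\<^sub>R ?p))"
    using taylor_dirderiv[OF g, of 0 ?p 1] g0 by (simp add: numeral_2_eq_2)
  also have "(\<lambda>t. (1 - t) * (dirderiv ?p ^^ 2) g (0 + t *\<^sub>R ?p)) = (\<lambda>t. (z $ i)\<^sup>2 * ((1 - t) * ?d i i t)
      + z $ i * z $ j * (2 * ((1 - t) * ?d i j t)) + (z $ j)\<^sup>2 * ((1 - t) * ?d j j t))"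
    by (subst plane_part_def) (simp add: dirderiv_square_plane[OF g] algebra_simps)
  also have "integral {0..1} \<dots> = (z $ i)\<^sup>2 * I i i + z $ i * z $ j * (2 * I i j) + (z $ j)\<^sup>2 * I j j"
    by (intro integral_unique has_integral_add has_integral_mult_right I)
  finally show ?thesis by simp
qed

text \<open>Meant for \<open>f\<close> itself, whose first and second order terms vanish along the
  kernel plane. The factors 3 come from the equality of mixed derivatives.\<close>

lemma taylor_cube_plane:
  fixes g :: "real^'n::finite \<Rightarrow> real"
  assumes g: "smooth_on UNIV g"
    and g0: "dirderiv (plane_part i j z) g 0 = 0" "(dirderiv (plane_part i j z) ^^ 2) g 0 = 0"
  defines "I u v w \<equiv> integral {0..1} (\<lambda>t. ((1 - t)\<^sup>2 / 2)
    * dirderiv (axis u 1) (dirderiv (axis v 1) (dirderiv (axis w 1) g)) (0 + t *\<^sub>R plane_part i j z))"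
  shows "g (plane_part i j z) = g 0 + cubic (I i i i, 3 * I i i j, 3 * I i j j, I j j j) (z $ i) (z $ j)"
proof -
  let ?p = "plane_part i j z"
  let ?d = "\<lambda>u v w t. dirderiv (axis u 1) (dirderiv (axis v 1) (dirderiv (axis w 1) g)) (0 + t *\<^sub>R ?p)"
  have I: "((\<lambda>t. ((1 - t)\<^sup>2 / 2) * ?d u v w t) has_integral I u v w) {0..1}" for u v w
    unfolding I_def
    by (rule has_integral_along_segment) (auto intro!: smooth_on_dirderiv g continuous_intros)
  have "g (0 + ?p) = g 0 + integral {0..1} (\<lambda>t. ((1 - t)\<^sup>2 / 2) * (dirderiv ?p ^^ 3) g (0 + t *\<^sub>R ?p))"
    using taylor_dirderiv[OF g, of 0 ?p 2] g0 by (simp add: numeral_2_eq_2 numeral_3_eq_3)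
  also have "(\<lambda>t. ((1 - t)\<^sup>2 / 2) * (dirderiv ?p ^^ 3) g (0 + t *\<^sub>R ?p)) = (\<lambda>t. (z $ i)^3 * (((1 - t)\<^sup>2 / 2) * ?d i i i t)
      + (z $ i)\<^sup>2 * z $ j * (3 * (((1 - t)\<^sup>2 / 2) * ?d i i j t)) + z $ i * (z $ j)\<^sup>2 * (3 * (((1 - t)\<^sup>2 / 2) * ?d i j j t))
      + (z $ j)^3 * (((1 - t)\<^sup>2 / 2) * ?d j j j t))"
    by (subst plane_part_def) (simp add: dirderiv_cube_plane[OF g] distrib_left mult_ac)
  also have "integral {0..1} \<dots> = (z $ i)^3 * I i i i + (z $ i)\<^sup>2 * z $ j * (3 * I i i j)
      + z $ i * (z $ j)\<^sup>2 * (3 * I i j j) + (z $ j)^3 * I j j j"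
    by (intro integral_unique has_integral_add has_integral_mult_right I)
  finally show ?thesis by (simp add: cubic_def mult.commute mult.left_commute)
qed

text \<open>Taylor's formula is used twice: first from the plane point along the remaining
  directions, where the second order remainder gives \<open>q\<close>; then from 0 along the plane,
  for \<open>f\<close> and for its first partial derivatives. The kernel condition removes the
  linear terms of those partial derivatives, so \<open>b1\<close>, \<open>b2\<close>,
  \<open>b3\<close> come with quadratic monomials.\<close>

theorem smooth_plane_decomposition:
  fixes f :: "real^'n::finite \<Rightarrow> real"
  assumes ij: "i \<noteq> j" and f: "smooth_on UNIV f" and crit: "critical_point f 0"
    and ker: "second_differential_kernel f 0 = coordinate_plane i j"
  defines "d u v w \<equiv> dirderiv (axis u 1) (dirderiv (axis v 1) (dirderiv (axis w 1) f)) 0"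
  obtains a b1 b2 b3 q where
    "smooth_on UNIV a" "smooth_on UNIV b1" "smooth_on UNIV b2" "smooth_on UNIV b3" "smooth_on UNIV q"
    "a 0 = (d i i i / 6, d i i j / 2, d i j j / 2, d j j j / 6)"
    "\<And>z. f z = f 0 + cubic (a z) (z $ i) (z $ j)
      + rest_part i j z \<bullet> ((z $ i)\<^sup>2 *\<^sub>R b1 z + (z $ i * z $ j) *\<^sub>R b2 z + (z $ j)\<^sup>2 *\<^sub>R b3 z)
      + rest_part i j z \<bullet> (q z *v rest_part i j z)"
    "\<And>z l. l \<in> {i, j} \<Longrightarrow> b1 z $ l = 0" "\<And>z l. l \<in> {i, j} \<Longrightarrow> b2 z $ l = 0" "\<And>z l. l \<in> {i, j} \<Longrightarrow> b3 z $ l = 0"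
    "\<And>z. transpose (q z) = q z" "invertible (q 0)"
    "\<And>z l m. l \<in> {i, j} \<or> m \<in> {i, j} \<Longrightarrow> q z $ l $ m = (if l = m then 1 else 0)"
proof -
  let ?P = "plane_part i j" and ?R = "rest_part i j"
  define pd where "pd l g = dirderiv (axis l 1) g" for l :: 'n and g :: "real^'n \<Rightarrow> real"
  have spd: "smooth_on UNIV g \<Longrightarrow> smooth_on UNIV (pd l g)" for l g
    unfolding pd_def by (rule smooth_on_dirderiv)
  have f1: "dirderiv v f 0 = 0" for v
    using crit by (simp add: critical_point_def dirderiv_eqI)
  have sd: "second_differential f 0 u v = dirderiv v (dirderiv u f) 0" for u v
    by (simp add: second_differential_def dirderiv_def)
  have Pplane: "?P z \<in> coordinate_plane i j" for z
    by (simp add: coordinate_plane_def plane_part_nth[OF ij])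
  have f2: "dirderiv v (dirderiv (?P z) f) 0 = 0" for v z
    using Pplane[of z] by (simp add: ker[symmetric] second_differential_kernel_def sd)
  define I where "I u v w z = integral {0..1} (\<lambda>t. ((1 - t)\<^sup>2 / 2) * pd u (pd v (pd w f)) (0 + t *\<^sub>R ?P z))" for u v w z
  define a where "a z = (I i i i z, 3 * I i i j z, 3 * I i j j z, I j j j z)" for z
  define K where "K u v l z = integral {0..1} (\<lambda>t. (1 - t) * pd u (pd v (pd l f)) (0 + t *\<^sub>R ?P z))" for u v l z
  define b where "b c u v z = (\<chi> l. if l \<in> {i, j} then 0 else c * K u v l z)" for c u v z
  define H where "H l m z = integral {0..1} (\<lambda>t. (1 - t) * pd m (pd l f) (?P z + t *\<^sub>R ?R z))" for l m z
  \<comment> \<open>The block of the plane indices is filled with an identity matrix. It never meets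
    \<open>rest_part\<close>, and it makes \<open>q 0\<close> an invertible matrix of full
    size.\<close>
  define q where "q z = (\<chi> l m. if l \<in> {i, j} \<or> m \<in> {i, j} then (if l = m then 1 else 0) else H l m z)" for z
  have sI: "smooth_on UNIV (I u v w)" for u v w
    unfolding I_def
    by (rule smooth_on_param_integral_real[OF bounded_linear_zero bounded_linear_plane_part])
      (auto intro!: spd f continuous_intros)
  have sK: "smooth_on UNIV (K u v w)" for u v w
    unfolding K_def
    by (rule smooth_on_param_integral_real[OF bounded_linear_zero bounded_linear_plane_part])
      (intro spd f continuous_intros)+
  have sH: "smooth_on UNIV (H l m)" for l m
    unfolding H_def
    by (rule smooth_on_param_integral_real[OF bounded_linear_plane_part bounded_linear_rest_part])
      (intro spd f continuous_intros)+
  have sa: "smooth_on UNIV a"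
    unfolding a_def[abs_def] by (intro smooth_intros sI open_UNIV)
  have sb: "smooth_on UNIV (b c u v)" for c u v
  proof (rule smooth_on_vec[OF open_UNIV])
    show "smooth_on UNIV (\<lambda>z. b c u v z $ l)" for l
      by (cases "l \<in> {i, j}") (auto simp: b_def intro!: smooth_intros sK)
  qed
  have sq: "smooth_on UNIV q"
  proof (intro smooth_on_vec[OF open_UNIV])
    show "smooth_on UNIV (\<lambda>z. q z $ l $ m)" for l m
      using sH[of l m] by (cases "l \<in> {i, j} \<or> m \<in> {i, j}") (auto simp: q_def)
  qed
  have comm: "pd m (pd l f) z = pd l (pd m f) z" for l m z
    unfolding pd_def by (rule dirderiv_commute[OF f])
  have a0: "a 0 = (d i i i / 6, d i i j / 2, d i j j / 2, d j j j / 6)"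
  proof -
    \<comment> \<open>The weight \<open>(1 - t)\<^sup>2 / 2\<close> has integral 1/6; the factors 3
      in \<open>a\<close> then turn the middle coefficients into halves.\<close>
    have *: "I u v w 0 = d u v w / 6" for u v w
      using integral_power_1_minus[of 2] by (simp add: I_def d_def pd_def plane_part_def)
    show ?thesis unfolding a_def * by simp
  qed
  have fP: "f (?P z) = f 0 + cubic (a z) (z $ i) (z $ j)" for z
    unfolding a_def I_def pd_def
    by (rule taylor_cube_plane[OF f f1]) (simp add: numeral_2_eq_2 f2)
  have fPl: "pd l f (?P z) = (z $ i)\<^sup>2 * K i i l z + z $ i * z $ j * (2 * K i j l z) + (z $ j)\<^sup>2 * K j j l z" for l z
    unfolding pd_def K_def
    by (rule taylor_square_plane[OF smooth_on_dirderiv[OF f] f1])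
      (subst dirderiv_commute[OF f], rule f2)
  have decomp: "f z = f 0 + cubic (a z) (z $ i) (z $ j)
      + ?R z \<bullet> ((z $ i)\<^sup>2 *\<^sub>R b 1 i i z + (z $ i * z $ j) *\<^sub>R b 2 i j z + (z $ j)\<^sup>2 *\<^sub>R b 1 j j z)
      + ?R z \<bullet> (q z *v ?R z)" for z
  proof -
    have "f z = f (?P z + ?R z)" by (simp add: plane_part_add_rest_part)
    also have "\<dots> = f (?P z) + dirderiv (?R z) f (?P z)
        + integral {0..1} (\<lambda>t. (1 - t) * (dirderiv (?R z) ^^ 2) f (?P z + t *\<^sub>R ?R z))"
      using taylor_dirderiv[OF f, of "?P z" "?R z" 1] by (simp add: numeral_2_eq_2)
    also have "dirderiv (?R z) f (?P z) = (\<Sum>l\<in>UNIV. ?R z $ l * pd l f (?P z))"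
      unfolding pd_def by (rule dirderiv_eq_sum_axis[OF f])
    also have "\<dots> = ?R z \<bullet> ((z $ i)\<^sup>2 *\<^sub>R b 1 i i z + (z $ i * z $ j) *\<^sub>R b 2 i j z + (z $ j)\<^sup>2 *\<^sub>R b 1 j j z)"
      unfolding inner_vec_def fPl by (rule sum.cong) (auto simp: b_def rest_part_nth[OF ij])
    also have "integral {0..1} (\<lambda>t. (1 - t) * (dirderiv (?R z) ^^ 2) f (?P z + t *\<^sub>R ?R z))
      = integral {0..1} (\<lambda>t. \<Sum>l\<in>UNIV. \<Sum>m\<in>UNIV. ?R z $ l * ?R z $ m * ((1 - t) * pd m (pd l f) (?P z + t *\<^sub>R ?R z)))"
      unfolding dirderiv_square_eq_sum_axis[OF f] pd_def[symmetric] sum_distrib_left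
      by (simp only: mult.left_commute mult.assoc)
    also have "\<dots> = (\<Sum>l\<in>UNIV. \<Sum>m\<in>UNIV. ?R z $ l * ?R z $ m * H l m z)"
      unfolding H_def
      by (intro integral_unique has_integral_sum has_integral_mult_right has_integral_along_segment)
        (auto intro!: spd f continuous_intros)
    also have "\<dots> = ?R z \<bullet> (q z *v ?R z)"
      unfolding inner_vec_def matrix_vector_mult_def
      by (auto simp: sum_distrib_left q_def rest_part_nth[OF ij] intro!: sum.cong)
    finally show ?thesis by (simp add: fP)
  qed
  have inv: "invertible (q 0)"
  proof -
    have H0: "H l m 0 = pd m (pd l f) 0 / 2" for l m
      using integral_power_1_minus[of 1] by (simp add: H_def plane_part_def rest_part_def)
    \<comment> \<open>The identity rows force the two plane coordinates of \<open>v\<close> to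
      vanish. The other rows are half the second differential, so \<open>v\<close> lies in its
      kernel, which is the plane itself.\<close>
    have "v = 0" if v: "q 0 *v v = 0" for v
    proof -
      have vl: "(\<Sum>m\<in>UNIV. q 0 $ l $ m * v $ m) = 0" for l
        using v by (simp add: vec_eq_iff matrix_vector_mult_def)
      have v0: "v $ l = 0" if "l \<in> {i, j}" for l
      proof -
        have "(\<Sum>m\<in>UNIV. q 0 $ l $ m * v $ m) = (\<Sum>m\<in>UNIV. if m = l then v $ m else 0)"
          using that by (intro sum.cong) (auto simp: q_def)
        then show ?thesis using vl[of l] by simp
      qed
      have sdl: "second_differential f 0 v (axis l 1) = 0" for l
      proof (cases "l \<in> {i, j}")
        case True
        then have "axis l 1 \<in> second_differential_kernel f 0"
          unfolding ker by (auto simp: coordinate_plane_def axis_def)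
        then show ?thesis
          unfolding sd by (subst dirderiv_commute[OF f]) (simp add: second_differential_kernel_def sd)
      next
        case False
        have "second_differential f 0 v (axis l 1) = dirderiv v (pd l f) 0"
          unfolding sd pd_def by (rule dirderiv_commute[OF f])
        also have "\<dots> = (\<Sum>m\<in>UNIV. v $ m * pd m (pd l f) 0)"
          by (subst dirderiv_eq_sum_axis[OF spd[OF f]]) (simp add: pd_def)
        also have "\<dots> = 2 * (\<Sum>m\<in>UNIV. q 0 $ l $ m * v $ m)"
          unfolding sum_distrib_left using False v0 by (intro sum.cong) (auto simp: q_def H0)
        finally show ?thesis by (simp add: vl)
      qed
      have "second_differential f 0 v w = 0" for w
        unfolding sd by (subst dirderiv_eq_sum_axis[OF smooth_on_dirderiv[OF f]]) (simp add: sdl flip: sd)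
      then have "v \<in> coordinate_plane i j"
        by (simp add: ker[symmetric] second_differential_kernel_def)
      then show "v = 0"
        using v0 by (auto simp: coordinate_plane_def vec_eq_iff)
    qed
    then show ?thesis
      by (simp add: invertible_left_inverse matrix_left_invertible_ker)
  qed
  show thesis
  proof (rule that[OF sa sb sb sb sq a0 decomp])
    show "transpose (q z) = q z" for z
      by (auto simp: transpose_def vec_eq_iff q_def H_def comm)
    show "invertible (q 0)" by (rule inv)
  qed (auto simp: b_def q_def)
qed

subsection \<open>Completing the square and reduction to normal form\<close>

text \<open>Smoothness of the solution is smoothness of the inverse operator family on basis
  vectors, recombined with the coordinates of \<open>g\<close>.\<close>

lemma smooth_linear_solve:
  fixes q :: "'b::real_normed_vector \<Rightarrow> real^'n::finite^'n"
  assumes V: "open V" and q: "smooth_on V q" and inv: "\<And>z. z \<in> V \<Longrightarrow> invertible (q z)"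
    and g: "smooth_on V g"
  obtains s where "smooth_on V s" "\<And>z. z \<in> V \<Longrightarrow> q z *v s z = g z"
proof -
  let ?A = "\<lambda>z. (*v) (q z)"
  have lin: "linear (?A z)" for z by simp
  have bij: "bij (?A z)" if "z \<in> V" for z
    using inv[OF that] by (simp add: invertible_eq_bij)
  have "smooth_on V (\<lambda>z. inv (?A z) c)" for c
    unfolding smooth_on_def
  proof (intro allI Cn_on_inv_family lin V)
    show "inj (?A z)" if "z \<in> V" for z using bij[OF that] by (rule bij_is_inj)
    show "Cn_on n V (\<lambda>y. q y *v b)" for n b
      by (intro smooth_onD smooth_on_bilinear[OF V bounded_bilinear_matrix_vector_mult] q smooth_on_const)
  qed
  then have "smooth_on V (\<lambda>z. \<Sum>b\<in>Basis. (g z \<bullet> b) *\<^sub>R inv (?A z) b)"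
    by (intro smooth_intros V g)
  moreover have "q z *v (\<Sum>b\<in>Basis. (g z \<bullet> b) *\<^sub>R inv (?A z) b) = g z" if "z \<in> V" for z
  proof -
    have "q z *v inv (?A z) b = b" for b
      using bij[OF that] by (simp add: bij_is_surj surj_f_inv_f)
    then show ?thesis
      by (simp add: linear_sum[OF lin] matrix_vector_mult_scaleR euclidean_representation)
  qed
  ultimately show thesis by (rule that)
qed

lemma open_invertible:
  fixes q :: "'b::real_normed_vector \<Rightarrow> real^'n::finite^'n"
  assumes "continuous_on UNIV q"
  shows "open {z. invertible (q z)}"
proof -
  have "continuous_on UNIV (\<lambda>z. det (q z))"
    unfolding det_def by (intro continuous_intros assms continuous_on_component)
  then have "open ((\<lambda>z. det (q z)) -` (- {0}))"
    by (intro open_vimage) auto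
  then show ?thesis by (simp add: invertible_det_nz vimage_def)
qed

lemma symmetric_matrix_inner:
  fixes q :: "real^'n::finite^'n"
  assumes "transpose q = q"
  shows "u \<bullet> (q *v v) = v \<bullet> (q *v u)"
  by (metis assms dot_lmul_matrix inner_commute vector_transpose_matrix)

text \<open>With \<open>\<beta>\<close> the quadratic expression in the \<open>b\<close>s and
  \<open>q s = \<beta> / 2\<close>, symmetry of \<open>q\<close> gives that
  \<open>r \<bullet> \<beta> + r \<bullet> q r\<close> equals the square at \<open>r + s\<close>
  minus \<open>s \<bullet> \<beta> / 2\<close>. Being quadratic in the plane coordinates,
  \<open>s\<close> has zero derivative at 0 and does not affect the linear part of the new
  coordinates.\<close>

lemma complete_the_square:
  fixes b1 b2 b3 :: "real^'n::finite \<Rightarrow> real^'n" and q :: "real^'n \<Rightarrow> real^'n^'n"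
  assumes ij: "i \<noteq> j"
    and sm: "smooth_on UNIV a" "smooth_on UNIV b1" "smooth_on UNIV b2" "smooth_on UNIV b3" "smooth_on UNIV q"
    and b0: "\<And>z l. l \<in> {i, j} \<Longrightarrow> b1 z $ l = 0" "\<And>z l. l \<in> {i, j} \<Longrightarrow> b2 z $ l = 0"
      "\<And>z l. l \<in> {i, j} \<Longrightarrow> b3 z $ l = 0"
    and sym: "\<And>z. transpose (q z) = q z" and inv: "invertible (q 0)"
    and blk: "\<And>z l m. l \<in> {i, j} \<or> m \<in> {i, j} \<Longrightarrow> q z $ l $ m = (if l = m then 1 else 0)"
  obtains V a' s where "open V" "0 \<in> V" "smooth_on V a'" "smooth_on V s" "a' 0 = a 0" "s 0 = 0"
    "(s has_derivative (\<lambda>v. 0)) (at 0)" "\<And>z l. z \<in> V \<Longrightarrow> l \<in> {i, j} \<Longrightarrow> s z $ l = 0"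
    "\<And>z. z \<in> V \<Longrightarrow> cubic (a z) (z $ i) (z $ j)
      + rest_part i j z \<bullet> ((z $ i)\<^sup>2 *\<^sub>R b1 z + (z $ i * z $ j) *\<^sub>R b2 z + (z $ j)\<^sup>2 *\<^sub>R b3 z)
      + rest_part i j z \<bullet> (q z *v rest_part i j z)
      = cubic (a' z) (z $ i) (z $ j) + (rest_part i j z + s z) \<bullet> (q z *v (rest_part i j z + s z))"
proof -
  define V where "V = {z. invertible (q z)}"
  have V: "open V" "0 \<in> V"
    using open_invertible[OF smooth_on_imp_continuous_on[OF sm(5)]] inv by (auto simp: V_def)
  have sV: "smooth_on V g" if "smooth_on UNIV g" for g :: "real^'n \<Rightarrow> 'c::real_normed_vector"
    by (rule smooth_on_subset[OF that]) simp
  \<comment> \<open>Solving for each of \<open>b1\<close>, \<open>b2\<close>, \<open>b3\<close>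
    separately keeps the monomials in the plane coordinates visible, both in \<open>s\<close> and in
    the correction.\<close>
  have solve: "\<exists>s. smooth_on V s \<and> (\<forall>z\<in>V. q z *v s z = (1/2) *\<^sub>R b z) \<and> (\<forall>z\<in>V. \<forall>l\<in>{i,j}. s z $ l = 0)"
    if b: "smooth_on UNIV b" and b0: "\<And>z l. l \<in> {i, j} \<Longrightarrow> b z $ l = 0" for b
  proof -
    have half: "smooth_on V (\<lambda>z. (1/2) *\<^sub>R b z)" by (intro smooth_intros V sV b)
    obtain s where s: "smooth_on V s" "\<And>z. z \<in> V \<Longrightarrow> q z *v s z = (1/2) *\<^sub>R b z"
      by (rule smooth_linear_solve[OF V(1) sV[OF sm(5)] _ half]) (auto simp: V_def)
    \<comment> \<open>Row \<open>l\<close> of \<open>q z\<close> is a row of the identity, so the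
      equation reads off this coordinate of \<open>s z\<close> directly.\<close>
    have "s z $ l = 0" if z: "z \<in> V" and l: "l \<in> {i, j}" for z l
    proof -
      have "(q z *v s z) $ l = (\<Sum>m\<in>UNIV. if m = l then s z $ m else 0)"
        unfolding matrix_vector_mult_def vec_lambda_beta by (rule sum.cong) (use l in \<open>auto simp: blk\<close>)
      then show ?thesis using s(2)[OF z] b0[OF l, of z] by simp
    qed
    with s show ?thesis by blast
  qed
  obtain s1 where s1: "smooth_on V s1" "\<forall>z\<in>V. q z *v s1 z = (1/2) *\<^sub>R b1 z" "\<forall>z\<in>V. \<forall>l\<in>{i,j}. s1 z $ l = 0"
    using solve[OF sm(2) b0(1)] by blast
  obtain s2 where s2: "smooth_on V s2" "\<forall>z\<in>V. q z *v s2 z = (1/2) *\<^sub>R b2 z" "\<forall>z\<in>V. \<forall>l\<in>{i,j}. s2 z $ l = 0"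
    using solve[OF sm(3) b0(2)] by blast
  obtain s3 where s3: "smooth_on V s3" "\<forall>z\<in>V. q z *v s3 z = (1/2) *\<^sub>R b3 z" "\<forall>z\<in>V. \<forall>l\<in>{i,j}. s3 z $ l = 0"
    using solve[OF sm(4) b0(3)] by blast
  note s = s1(1) s2(1) s3(1)
  note qs = s1(2)[rule_format] s2(2)[rule_format] s3(2)[rule_format]
  note s0 = s1(3)[rule_format] s2(3)[rule_format] s3(3)[rule_format]
  define s where "s z = (z $ i)\<^sup>2 *\<^sub>R s1 z + (z $ i * z $ j) *\<^sub>R s2 z + (z $ j)\<^sup>2 *\<^sub>R s3 z" for z
  \<comment> \<open>The correction \<open>s \<bullet> q s\<close> is quartic in \<open>z $ i, z $ j\<close>; one factor of each monomial goes into the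
    coefficients of the cubic.\<close>
  define a' where "a' z = a z - (1/2) *\<^sub>R
      (z $ i * (s1 z \<bullet> b1 z) + z $ j * (s1 z \<bullet> b2 z + s2 z \<bullet> b1 z),
       z $ j * (s1 z \<bullet> b3 z + s2 z \<bullet> b2 z + s3 z \<bullet> b1 z),
       z $ j * (s2 z \<bullet> b3 z + s3 z \<bullet> b2 z), z $ j * (s3 z \<bullet> b3 z))" for z
  have ss: "smooth_on V s" unfolding s_def[abs_def] by (intro smooth_intros V s)
  have sa': "smooth_on V a'" unfolding a'_def[abs_def] by (intro smooth_intros V s sV sm)
  note D = smooth_on_has_derivative[OF s(1) V(2)] smooth_on_has_derivative[OF s(2) V(2)]
    smooth_on_has_derivative[OF s(3) V(2)]
  have nth: "((\<lambda>z. z $ l) has_derivative (\<lambda>v. v $ l)) (at 0)" for l :: 'n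
    by (rule bounded_linear_imp_has_derivative[OF bounded_linear_vec_nth])
  have Ds: "(s has_derivative (\<lambda>v. 0)) (at 0)"
    unfolding s_def[abs_def]
    by (rule derivative_eq_intros D nth refl | simp)+
  have main: "cubic (a z) x y + r \<bullet> \<beta> + r \<bullet> (q z *v r) = cubic (a' z) x y + (r + s z) \<bullet> (q z *v (r + s z))"
    if z: "z \<in> V" and "x = z $ i" "y = z $ j" and
      \<beta>: "\<beta> = x\<^sup>2 *\<^sub>R b1 z + (x * y) *\<^sub>R b2 z + y\<^sup>2 *\<^sub>R b3 z" for z r x y \<beta>
  proof -
    have q\<beta>: "q z *v s z = (1/2) *\<^sub>R \<beta>"
      by (simp add: s_def \<beta> that(2,3) matrix_vector_right_distrib matrix_vector_mult_scaleR qs[OF z] scaleR_add_right)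
    have "(r + s z) \<bullet> (q z *v (r + s z)) = r \<bullet> (q z *v r) + 2 * (r \<bullet> (q z *v s z)) + s z \<bullet> (q z *v s z)"
      using symmetric_matrix_inner[OF sym, of r z "s z"]
      by (simp add: matrix_vector_right_distrib inner_add_left inner_add_right)
    then have *: "(r + s z) \<bullet> (q z *v (r + s z)) = r \<bullet> (q z *v r) + r \<bullet> \<beta> + (1/2) * (s z \<bullet> \<beta>)"
      by (simp add: q\<beta>)
    obtain A B C D where a: "a z = (A, B, C, D)" by (metis prod_cases4)
    have "s z = x\<^sup>2 *\<^sub>R s1 z + (x * y) *\<^sub>R s2 z + y\<^sup>2 *\<^sub>R s3 z" by (simp add: s_def that)
    then have "s z \<bullet> \<beta> = x^3 * (x * (s1 z \<bullet> b1 z) + y * (s1 z \<bullet> b2 z + s2 z \<bullet> b1 z))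
       + x\<^sup>2 * y * (y * (s1 z \<bullet> b3 z + s2 z \<bullet> b2 z + s3 z \<bullet> b1 z))
       + x * y\<^sup>2 * (y * (s2 z \<bullet> b3 z + s3 z \<bullet> b2 z)) + y^3 * (y * (s3 z \<bullet> b3 z))"
      unfolding \<beta> by (simp add: inner_add_left inner_add_right power2_eq_square power3_eq_cube algebra_simps)
    moreover have "cubic (a' z) x y = cubic (a z) x y - (1/2) * \<dots>"
      by (simp add: a'_def a cubic_def that(2,3)) algebra
    ultimately have "cubic (a' z) x y = cubic (a z) x y - (1/2) * (s z \<bullet> \<beta>)" by simp
    with * show ?thesis by simp
  qed
  show thesis
  proof (rule that[OF V sa' ss _ _ Ds])
    show "a' 0 = a 0" "s 0 = 0" by (simp_all add: a'_def s_def flip: zero_prod_def)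
    show "s z $ l = 0" if "z \<in> V" "l \<in> {i, j}" for z l
      by (simp add: s_def s0[OF that])
  qed (rule main; simp)
qed

text \<open>A null vector of the block, extended by zero to the plane coordinates, is a null vector
  of the whole matrix because the mixed entries vanish.\<close>

lemma nondegenerate_quadratic_form_block:
  fixes q :: "real^'n::finite^'n"
  assumes sym: "transpose q = q" and inv: "invertible q"
    and blk: "\<And>l m. l \<in> {i, j} \<or> m \<in> {i, j} \<Longrightarrow> q $ l $ m = (if l = m then 1 else 0)"
  shows "nondegenerate_quadratic_form (UNIV - {i, j})
    (\<lambda>x. \<Sum>l\<in>UNIV - {i, j}. \<Sum>m\<in>UNIV - {i, j}. q $ l $ m * x $ l * x $ m)"
  unfolding nondegenerate_quadratic_form_def
proof (intro exI[of _ "\<lambda>l m. q $ l $ m"] conjI allI impI ballI)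
  show "q $ l $ m = q $ m $ l" for l m
    using sym by (metis (mono_tags) transpose_def vec_lambda_beta)
  fix x :: "real^'n" and l
  assume x: "\<forall>l\<in>UNIV - {i, j}. (\<Sum>m\<in>UNIV - {i, j}. q $ l $ m * x $ m) = 0" and l: "l \<in> UNIV - {i, j}"
  define v where "v = (\<chi> l. if l \<in> {i, j} then 0 else x $ l)"
  have "(q *v v) $ k = 0" for k
  proof -
    have "(q *v v) $ k = (\<Sum>m\<in>UNIV - {i, j}. q $ k $ m * v $ m)"
      unfolding matrix_vector_mult_def vec_lambda_beta
      by (rule sum.mono_neutral_right) (auto simp: v_def)
    also have "\<dots> = (\<Sum>m\<in>UNIV - {i, j}. q $ k $ m * x $ m)"
      by (rule sum.cong) (auto simp: v_def)
    also have "\<dots> = 0"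
    proof (cases "k \<in> {i, j}")
      case True
      then show ?thesis by (intro sum.neutral) (auto simp: blk)
    qed (use x in auto)
    finally show ?thesis .
  qed
  then have "q *v v = 0" by (simp add: vec_eq_iff)
  then have "v = 0"
    using inv by (metis invertible_left_inverse matrix_left_invertible_ker)
  then show "x $ l = 0" using l by (auto simp: v_def vec_eq_iff split: if_splits)
qed auto

text \<open>The new coordinates combine a fixed linear change bringing the cubic at 0 to normal
  form, a near-identity change of the plane coordinates that follows the cubic as \<open>z\<close>
  varies, and the matrix \<open>X z\<close> acting on the completed square.\<close>

theorem smooth_reduction_to_normal_form:
  fixes f :: "real^'n::finite \<Rightarrow> real"
  assumes ij: "i \<noteq> j" and f: "smooth_on UNIV f" and crit: "critical_point f 0"
    and ker: "second_differential_kernel f 0 = coordinate_plane i j"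
  defines "d u v w \<equiv> dirderiv (axis u 1) (dirderiv (axis v 1) (dirderiv (axis w 1) f)) 0"
  assumes e: "e * cubic_disc (d i i i / 6, d i i j / 2, d i j j / 2, d j j j / 6) > 0"
  shows "\<exists>Q. nondegenerate_quadratic_form (UNIV - {i, j}) Q \<and>
    reduces_near_0 f (\<lambda>x. f 0 + (x $ i)\<^sup>2 * x $ j + e * (x $ j)^3 + Q x)"
proof -
  let ?R = "rest_part i j"
  obtain a b1 b2 b3 q where
      fz: "\<And>z. f z = f 0 + cubic (a z) (z $ i) (z $ j)
      + ?R z \<bullet> ((z $ i)\<^sup>2 *\<^sub>R b1 z + (z $ i * z $ j) *\<^sub>R b2 z + (z $ j)\<^sup>2 *\<^sub>R b3 z) + ?R z \<bullet> (q z *v ?R z)"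
    and sm: "smooth_on UNIV a" "smooth_on UNIV b1" "smooth_on UNIV b2" "smooth_on UNIV b3" "smooth_on UNIV q"
    and a0: "a 0 = (d i i i / 6, d i i j / 2, d i j j / 2, d j j j / 6)"
    and b0: "\<And>z l. l \<in> {i, j} \<Longrightarrow> b1 z $ l = 0" "\<And>z l. l \<in> {i, j} \<Longrightarrow> b2 z $ l = 0" "\<And>z l. l \<in> {i, j} \<Longrightarrow> b3 z $ l = 0"
    and q: "\<And>z. transpose (q z) = q z" "invertible (q 0)"
      "\<And>z l m. l \<in> {i, j} \<or> m \<in> {i, j} \<Longrightarrow> q z $ l $ m = (if l = m then 1 else 0)"
  proof (rule smooth_plane_decomposition[OF ij f crit ker, folded d_def])
  qed (rule that)
  obtain V a' s where V: "open V" "0 \<in> V" and sV: "smooth_on V a'" "smooth_on V s"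
    and a'0: "a' 0 = a 0" and s0: "s 0 = 0" and Ds: "(s has_derivative (\<lambda>v. 0)) (at 0)"
    and s_nth: "\<And>z l. z \<in> V \<Longrightarrow> l \<in> {i, j} \<Longrightarrow> s z $ l = 0"
    and square: "\<And>z. z \<in> V \<Longrightarrow> cubic (a z) (z $ i) (z $ j)
      + ?R z \<bullet> ((z $ i)\<^sup>2 *\<^sub>R b1 z + (z $ i * z $ j) *\<^sub>R b2 z + (z $ j)\<^sup>2 *\<^sub>R b3 z) + ?R z \<bullet> (q z *v ?R z)
      = cubic (a' z) (z $ i) (z $ j) + (?R z + s z) \<bullet> (q z *v (?R z + s z))"
    by (rule complete_the_square[OF ij sm b0 q]) (assumption | rule that)+
  \<comment> \<open>Commuting with \<open>J\<close> means being block diagonal, so the new variables split as well.\<close>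
  define J :: "real^'n^'n" where "J = (\<chi> l m. if l = m then (if l \<in> {i, j} then -1 else 1) else 0)"
  have JM: "(J ** M) $ l $ m = (if l \<in> {i, j} then -1 else 1) * M $ l $ m"
    and MJ: "(M ** J) $ l $ m = M $ l $ m * (if m \<in> {i, j} then -1 else 1)" for M l m
    by (simp_all add: J_def matrix_matrix_mult_def if_distrib[of "\<lambda>x. x * _"] if_distrib[of "\<lambda>x. _ * x"] cong: if_cong)
  have Jv: "(J *v v) $ l = (if l \<in> {i, j} then - v $ l else v $ l)" for v l
    by (simp add: J_def matrix_vector_mult_def if_distrib[of "\<lambda>x. x * _"] cong: if_cong)
  have JJ: "J ** J = mat 1"
    by (auto simp: vec_eq_iff JM mat_def) (auto simp: J_def)
  have qJ: "J ** q z = q z ** J" for z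
    using q(3)[of _ _ z] by (auto simp: vec_eq_iff JM MJ)
  obtain V' X where V': "open V'" "0 \<in> V'" and sX: "smooth_on V' X" and X0: "X 0 = mat 1"
    and XqX: "\<And>z. z \<in> V' \<Longrightarrow> transpose (X z) ** q 0 ** X z = q z"
    and JX: "\<And>z. z \<in> V' \<Longrightarrow> J ** X z = X z ** J"
    by (rule smooth_congruence_of_symmetric_matrices[OF open_UNIV UNIV_I sm(5) q(1,2) JJ qJ]) (assumption | rule that)+
  obtain m1 m2 m3 m4 where w: "m1 * m4 - m2 * m3 \<noteq> 0" and m: "cubic_subst (m1, m2, m3, m4) (a 0) = (0, 1, 0, e)"
    by (rule cubic_normal_form[OF e[folded a0]])
  have "e \<noteq> 0" using e by auto
  then obtain W N where W: "open W" "(0, 1, 0, e) \<in> W" and sN: "smooth_on W N" and N0: "N (0, 1, 0, e) = (1, 0, 0, 1)"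
    and N: "\<And>k. k \<in> W \<Longrightarrow> cubic_subst (N k) (0, 1, 0, e) = k"
    by (rule cubic_orbit_section) (assumption | rule that)+
  \<comment> \<open>The cubic at \<open>z\<close> in the fixed new basis. It equals the normal form
    at \<open>z = 0\<close>, so nearby it stays in the domain of the section
    \<open>N\<close>.\<close>
  define \<kappa> where "\<kappa> z = cubic_subst (m1, m2, m3, m4) (a' z)" for z
  have s\<kappa>: "smooth_on V \<kappa>"
    unfolding \<kappa>_def cubic_subst_def case_prod_unfold by (intro smooth_intros V sV)
  define S where "S = V \<inter> \<kappa> -` W \<inter> V'"
  have \<kappa>0: "\<kappa> 0 = (0, 1, 0, e)" by (simp add: \<kappa>_def a'0 m)
  have S: "open S" "0 \<in> S" "S \<subseteq> V" "S \<subseteq> V'" "\<And>z. z \<in> S \<Longrightarrow> \<kappa> z \<in> W"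
    using continuous_open_preimage[OF smooth_on_imp_continuous_on[OF s\<kappa>] V(1) W(1)] V V' W(2)
    by (auto simp: S_def \<kappa>0)
  define M where "M z = N (\<kappa> z)" for z
  have sM: "smooth_on S M"
    unfolding M_def by (rule smooth_on_compose[OF S(1) W(1) smooth_on_subset[OF s\<kappa> S(3)] sN S(5)])
  have M0: "M 0 = (1, 0, 0, 1)" by (simp add: M_def \<kappa>0 N0)
  define w where "w = m1 * m4 - m2 * m3"
  \<comment> \<open>The inverse of the substitution \<open>(m1, m2, m3, m4)\<close>: evaluating
    \<open>\<kappa> z\<close> at \<open>(x', y')\<close> is evaluating \<open>a' z\<close> at the
    original plane coordinates.\<close>
  define x' y' where "x' z = (m4 * z $ i - m2 * z $ j) / w" and "y' z = (m1 * z $ j - m3 * z $ i) / w" for z :: "real^'n"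
  have bl: "bounded_linear x'" "bounded_linear y'"
    unfolding x'_def[abs_def] y'_def[abs_def]
    by (intro bounded_linear_divide[THEN bounded_linear_compose] bounded_linear_sub bounded_linear_const_mult
        bounded_linear_vec_nth)+
  define \<xi> \<eta> where "\<xi> z = fst (M z) * x' z + fst (snd (M z)) * y' z"
    and "\<eta> z = fst (snd (snd (M z))) * x' z + snd (snd (snd (M z))) * y' z" for z
  define \<rho> where "\<rho> z = X z *v (?R z + s z)" for z
  define \<phi> where "\<phi> z = \<xi> z *\<^sub>R axis i 1 + \<eta> z *\<^sub>R axis j 1 + \<rho> z" for z
  have cub: "cubic (a' z) (z $ i) (z $ j) = (\<xi> z)\<^sup>2 * \<eta> z + e * (\<eta> z)^3" if z: "z \<in> S" for z
  proof -
    have xy: "m1 * x' z + m2 * y' z = z $ i" "m3 * x' z + m4 * y' z = z $ j"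
    proof -
      have "m1 * x' z + m2 * y' z = (w * z $ i) / w" "m3 * x' z + m4 * y' z = (w * z $ j) / w"
        unfolding x'_def y'_def by (simp_all add: w_def algebra_simps flip: add_divide_distrib)
      then show "m1 * x' z + m2 * y' z = z $ i" "m3 * x' z + m4 * y' z = z $ j"
        using w by (simp_all add: w_def)
    qed
    obtain n1 n2 n3 n4 where n: "M z = (n1, n2, n3, n4)" by (metis prod_cases4)
    have "cubic (a' z) (z $ i) (z $ j) = cubic (\<kappa> z) (x' z) (y' z)"
      by (simp add: \<kappa>_def cubic_cubic_subst xy)
    also have "\<kappa> z = cubic_subst (n1, n2, n3, n4) (0, 1, 0, e)"
      using N[OF S(5)[OF z]] n by (simp add: M_def)
    finally show ?thesis
      unfolding cubic_cubic_subst by (simp add: \<xi>_def \<eta>_def n cubic_def)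
  qed
  \<comment> \<open>\<open>J\<close> negates the plane coordinates and fixes the others, so it fixes
    the shifted rest vector. As \<open>X z\<close> commutes with \<open>J\<close>, it also fixes
    \<open>\<rho> z\<close>, which therefore has no plane component.\<close>
  have \<rho>_nth: "\<rho> z $ l = 0" if z: "z \<in> S" and l: "l \<in> {i, j}" for z l
  proof -
    have "J *v (?R z + s z) = ?R z + s z"
      using s_nth[of z] z S(3) by (auto simp: vec_eq_iff Jv rest_part_nth[OF ij])
    moreover have "J *v \<rho> z = X z *v (J *v (?R z + s z))"
      using JX[of z] z S(4) by (simp add: \<rho>_def matrix_vector_mul_assoc subset_iff)
    ultimately have "J *v \<rho> z = \<rho> z" by (simp add: \<rho>_def)
    then show ?thesis using Jv[of "\<rho> z" l] l by simp
  qed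
  have sR: "smooth_on S ?R" by (rule smooth_on_linear[OF S(1) bounded_linear_rest_part])
  have s\<rho>: "smooth_on S \<rho>"
    unfolding \<rho>_def
    by (intro smooth_on_bilinear[OF S(1) bounded_bilinear_matrix_vector_mult] smooth_on_add S(1)
        smooth_on_subset[OF sX S(4)] smooth_on_subset[OF sV(2) S(3)] sR)
  have s\<phi>: "smooth_on S \<phi>"
    unfolding \<phi>_def \<xi>_def \<eta>_def
    by (intro smooth_intros S(1) sM s\<rho> smooth_on_linear[OF S(1) bl(1)] smooth_on_linear[OF S(1) bl(2)])
  have x'0: "x' 0 = 0" "y' 0 = 0" by (simp_all add: x'_def y'_def)
  have R0: "?R 0 = 0" by (simp add: rest_part_def plane_part_def)
  have \<phi>0: "\<phi> 0 = 0" by (simp add: \<phi>_def \<xi>_def \<eta>_def \<rho>_def x'0 R0 s0)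
  \<comment> \<open>All terms containing derivatives of \<open>M\<close> or \<open>X\<close> are
    multiplied by \<open>x'\<close>, \<open>y'\<close> or the shifted rest vector, which vanish at
    0; \<open>M 0\<close> and \<open>X 0\<close> are identities and \<open>s\<close> has zero
    derivative.\<close>
  have D\<phi>: "(\<phi> has_derivative (\<lambda>v. x' v *\<^sub>R axis i 1 + y' v *\<^sub>R axis j 1 + ?R v)) (at 0)"
  proof -
    have DM: "((\<lambda>z. L (M z)) has_derivative (\<lambda>v. L (dirderiv v M 0))) (at 0)" if "bounded_linear L"
      for L :: "real \<times> real \<times> real \<times> real \<Rightarrow> real"
      by (rule bounded_linear.has_derivative[OF that smooth_on_has_derivative[OF sM S(2)]])
    note Dxy = bounded_linear_imp_has_derivative[OF bl(1)] bounded_linear_imp_has_derivative[OF bl(2)]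
    have prod: "((\<lambda>z. L (M z) * g z) has_derivative (\<lambda>v. L (1, 0, 0, 1) * g v)) (at 0)"
      if L: "bounded_linear L" and g: "bounded_linear g" for L :: "real \<times> real \<times> real \<times> real \<Rightarrow> real" and g
      using has_derivative_mult[OF DM[OF L] bounded_linear_imp_has_derivative[OF g]]
      by (simp add: M0 linear_simps(3)[OF g])
    note bls = bounded_linear_fst bounded_linear_snd bounded_linear_compose[OF bounded_linear_fst]
      bounded_linear_compose[OF bounded_linear_snd]
    have D\<xi>: "(\<xi> has_derivative (\<lambda>v. x' v)) (at 0)"
      unfolding \<xi>_def[abs_def]
      using has_derivative_add[OF prod[of fst x'] prod[of "\<lambda>m. fst (snd m)" y']] bl
      by (simp add: bls)
    have D\<eta>: "(\<eta> has_derivative (\<lambda>v. y' v)) (at 0)"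
      unfolding \<eta>_def[abs_def]
      using has_derivative_add[OF prod[of "\<lambda>m. fst (snd (snd m))" x'] prod[of "\<lambda>m. snd (snd (snd m))" y']] bl
      by (simp add: bls)
    have DX: "(X has_derivative (\<lambda>v. dirderiv v X 0)) (at 0)"
      by (rule smooth_on_has_derivative[OF sX V'(2)])
    have "((\<lambda>z. ?R z + s z) has_derivative (\<lambda>v. ?R v + 0)) (at 0)"
      by (intro has_derivative_add Ds bounded_linear_imp_has_derivative bounded_linear_rest_part)
    from bounded_bilinear.FDERIV[OF bounded_bilinear_matrix_vector_mult DX this]
    have D\<rho>: "(\<rho> has_derivative ?R) (at 0)"
      unfolding \<rho>_def[abs_def] by (simp add: X0 R0 s0)
    show ?thesis
      unfolding \<phi>_def[abs_def]
      by (intro has_derivative_add has_derivative_scaleR_left D\<xi> D\<eta> D\<rho>)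
  qed
  have inj: "v = 0" if "dirderiv v \<phi> 0 = 0" for v
  proof -
    have eq: "x' v *\<^sub>R axis i 1 + y' v *\<^sub>R axis j 1 + ?R v = 0"
      using that dirderiv_eqI[OF D\<phi>] by simp
    have nth: "(x' v *\<^sub>R axis i 1 + y' v *\<^sub>R axis j 1 + ?R v) $ l = 0" for l
      unfolding eq by simp
    have "x' v = 0" "y' v = 0"
      using nth[of i] nth[of j] ij by (simp_all add: axis_def rest_part_nth[OF ij])
    then have *: "m4 * v $ i = m2 * v $ j" "m1 * v $ j = m3 * v $ i"
      using w by (simp_all add: x'_def y'_def w_def)
    then have "w * v $ i = 0" "w * v $ j = 0" unfolding w_def by algebra+
    then have "v $ i = 0" "v $ j = 0" using w by (simp_all add: w_def)
    then have "v $ l = 0" for l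
      using nth[of l] by (cases "l \<in> {i, j}") (auto simp: axis_def rest_part_nth[OF ij])
    then show "v = 0" by (simp add: vec_eq_iff)
  qed
  obtain U g where U: "open U" "U \<subseteq> S" "0 \<in> U" "open (\<phi> ` U)" "smooth_on (\<phi> ` U) g"
    "\<And>x. x \<in> U \<Longrightarrow> g (\<phi> x) = x"
    by (rule smooth_inverse_function[OF S(1) s\<phi> S(2) inj]) (assumption | rule that)+
  define Q where "Q x = (\<Sum>l\<in>UNIV - {i, j}. \<Sum>m\<in>UNIV - {i, j}. q 0 $ l $ m * x $ l * x $ m)" for x :: "real^'n"
  have nd: "nondegenerate_quadratic_form (UNIV - {i, j}) Q"
    unfolding Q_def by (rule nondegenerate_quadratic_form_block[OF q])
  have fU: "f z = f 0 + (\<phi> z $ i)\<^sup>2 * \<phi> z $ j + e * (\<phi> z $ j)^3 + Q (\<phi> z)" if "z \<in> U" for z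
  proof -
    have z: "z \<in> S" "z \<in> V" "z \<in> V'" using that U(2) S(3,4) by auto
    have \<phi>ij: "\<phi> z $ i = \<xi> z" "\<phi> z $ j = \<eta> z"
      using \<rho>_nth[OF z(1)] ij by (simp_all add: \<phi>_def axis_def)
    have \<phi>l: "\<phi> z $ l = \<rho> z $ l" if "l \<notin> {i, j}" for l
      using that by (simp add: \<phi>_def axis_def)
    let ?r = "?R z + s z"
    have "?r \<bullet> (q z *v ?r) = ?r \<bullet> (transpose (X z) *v (q 0 *v (X z *v ?r)))"
      by (simp add: XqX[OF z(3), symmetric] matrix_vector_mul_assoc matrix_mul_assoc)
    also have "\<dots> = \<rho> z \<bullet> (q 0 *v \<rho> z)"
      by (metis \<rho>_def dot_lmul_matrix transpose_transpose vector_transpose_matrix)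
    also have "\<dots> = (\<Sum>l\<in>UNIV. \<Sum>m\<in>UNIV. q 0 $ l $ m * \<rho> z $ l * \<rho> z $ m)"
      by (simp add: inner_vec_def matrix_vector_mult_def sum_distrib_left mult_ac)
    also have "\<dots> = (\<Sum>l\<in>UNIV - {i, j}. \<Sum>m\<in>UNIV. q 0 $ l $ m * \<rho> z $ l * \<rho> z $ m)"
      by (rule sum.mono_neutral_right) (auto simp: \<rho>_nth[OF z(1)])
    also have "\<dots> = (\<Sum>l\<in>UNIV - {i, j}. \<Sum>m\<in>UNIV - {i, j}. q 0 $ l $ m * \<rho> z $ l * \<rho> z $ m)"
      by (intro sum.cong refl sum.mono_neutral_right) (auto simp: \<rho>_nth[OF z(1)])
    also have "\<dots> = Q (\<phi> z)"
      by (simp add: Q_def \<phi>l)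
    finally have "?r \<bullet> (q z *v ?r) = Q (\<phi> z)" .
    then show ?thesis
      using fz[of z] square[OF z(2)] cub[OF z(1)] by (simp add: \<phi>ij)
  qed
  have "local_diffeo_fixing_0 U \<phi>"
    unfolding local_diffeo_fixing_0_def using U \<phi>0 smooth_on_subset[OF s\<phi> U(2)] by blast
  with fU nd show ?thesis
    unfolding reduces_near_0_def by blast
qed

subsection \<open>The discriminant of a reducible germ\<close>

lemma singular_2x2_kernel:
  fixes a b c d :: real
  assumes "a * d - b * c = 0"
  shows "\<exists>x y. (x \<noteq> 0 \<or> y \<noteq> 0) \<and> a * x + b * y = 0 \<and> c * x + d * y = 0"
proof (cases "c = 0 \<and> d = 0")
  case False
  then show ?thesis using assms by (intro exI[of _ d] exI[of _ "- c"]) (auto simp: algebra_simps)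
next
  case True
  show ?thesis
  proof (cases "a = 0 \<and> b = 0")
    case True
    with \<open>c = 0 \<and> d = 0\<close> show ?thesis by (intro exI[of _ 1] exI[of _ 0]) simp
  next
    case False
    with \<open>c = 0 \<and> d = 0\<close> show ?thesis by (intro exI[of _ b] exI[of _ "- a"]) auto
  qed
qed

text \<open>A single use of l'Hopital's rule suffices: \<open>h' t / t\<close> is the difference
  quotient of \<open>h'\<close> at 0, so no second derivative away from 0 is required.\<close>

lemma tendsto_over_square:
  fixes h h' :: "real \<Rightarrow> real"
  assumes der: "eventually (\<lambda>t. (h has_real_derivative h' t) (at t)) (nhds 0)"
    and h: "h 0 = 0" "h' 0 = 0" and h'': "(h' has_real_derivative D) (at 0)"
  shows "((\<lambda>t. h t / t\<^sup>2) \<longlongrightarrow> D / 2) (at 0)"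
proof (rule lhopital[where f'=h' and g'="\<lambda>t. 2 * t"])
  have "(h has_real_derivative h' 0) (at 0)" using eventually_nhds_x_imp_x[OF der] .
  then show "(h \<longlongrightarrow> 0) (at 0)" using DERIV_isCont[of h "h' 0" 0] h(1) by (simp add: isCont_def)
  show "((\<lambda>t::real. t\<^sup>2) \<longlongrightarrow> 0) (at 0)" by (rule tendsto_eq_intros refl | simp)+
  show "\<forall>\<^sub>F t in at (0::real). t\<^sup>2 \<noteq> 0" "\<forall>\<^sub>F t in at (0::real). 2 * t \<noteq> 0"
    by (auto simp: eventually_at_filter)
  show "\<forall>\<^sub>F t in at 0. (h has_real_derivative h' t) (at t)"
    using der by (auto simp: eventually_at_filter elim: eventually_mono)
  show "\<forall>\<^sub>F t in at (0::real). ((\<lambda>t. t\<^sup>2) has_real_derivative 2 * t) (at t)"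
    by (auto intro!: derivative_eq_intros eventuallyI)
  have "((\<lambda>t. h' t / t / 2) \<longlongrightarrow> D / 2) (at 0)"
    using h'' h(2) by (intro tendsto_divide) (auto simp: DERIV_def)
  then show "((\<lambda>t. h' t / (2 * t)) \<longlongrightarrow> D / 2) (at 0)"
    by (simp add: mult.commute)
qed

text \<open>If \<open>f = g \<circ> \<phi>\<close> with \<open>g\<close> in normal form, the second differentials show that \<open>D\<phi>(0)\<close> preserves the
  coordinate plane. The remaining components of \<open>\<phi>(t u)\<close> are then \<open>O(t\<^sup>2)\<close> for \<open>u\<close> in the plane, so
  comparing the terms of order \<open>t\<^sup>3\<close> relates the cubic forms of \<open>f\<close> and \<open>g\<close> by a linear substitution.\<close>

theorem cubic_disc_nonzero_of_reduction:
  fixes f :: "real^'n::finite \<Rightarrow> real"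
  assumes ij: "i \<noteq> j" and f: "smooth_on UNIV f" and crit: "critical_point f 0"
    and ker: "second_differential_kernel f 0 = coordinate_plane i j"
  defines "d u v w \<equiv> dirderiv (axis u 1) (dirderiv (axis v 1) (dirderiv (axis w 1) f)) 0"
  assumes e: "e \<noteq> 0" and nd: "nondegenerate_quadratic_form (UNIV - {i, j}) Q"
    and red: "reduces_near_0 f (\<lambda>x. c + (x $ i)\<^sup>2 * x $ j + e * (x $ j)^3 + Q x)"
  shows "cubic_disc (d i i i / 6, d i i j / 2, d i j j / 2, d j j j / 6) \<noteq> 0"
proof -
  let ?K = "UNIV - {i, j}"
  let ?k = "(d i i i / 6, d i i j / 2, d i j j / 2, d j j j / 6)"
  obtain q where qsym: "\<forall>l\<in>?K. \<forall>m\<in>?K. q l m = q m l"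
    and Q: "\<And>x. Q x = (\<Sum>l\<in>?K. \<Sum>m\<in>?K. q l m * x $ l * x $ m)"
    and qnd: "\<And>x :: real^'n. (\<forall>l\<in>?K. (\<Sum>m\<in>?K. q l m * x $ m) = 0) \<Longrightarrow> (\<forall>l\<in>?K. x $ l = 0)"
    using nd unfolding nondegenerate_quadratic_form_def by blast
  obtain U \<phi> where diffeo: "local_diffeo_fixing_0 U \<phi>"
    and fU: "\<And>k. k \<in> U \<Longrightarrow> f k = c + (\<phi> k $ i)\<^sup>2 * \<phi> k $ j + e * (\<phi> k $ j)^3 + Q (\<phi> k)"
    using red unfolding reduces_near_0_def by blast
  then obtain \<psi> where U: "open U" "0 \<in> U" and \<phi>0: "\<phi> 0 = 0" and s\<phi>: "smooth_on U \<phi>"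
    and s\<psi>: "smooth_on (\<phi> ` U) \<psi>" and \<psi>\<phi>: "\<And>x. x \<in> U \<Longrightarrow> \<psi> (\<phi> x) = x"
    unfolding local_diffeo_fixing_0_def by blast
  define L where "L v = dirderiv v \<phi> 0" for v
  have D\<phi>: "(\<phi> has_derivative (\<lambda>v. dirderiv v \<phi> x)) (at x)" if "x \<in> U" for x
    by (rule smooth_on_has_derivative[OF s\<phi> that])
  have DL: "(\<phi> has_derivative L) (at 0)"
    using D\<phi>[OF U(2)] by (simp add: L_def[abs_def])
  have linL: "linear L" using has_derivative_linear[OF DL] .
  have surjL: "surj L" and injL: "inj L"
  proof -
    have "(\<psi> has_derivative (\<lambda>v. dirderiv v \<psi> 0)) (at (\<phi> 0))"
      using smooth_on_has_derivative[OF s\<psi>, of 0] U(2) \<phi>0 by (metis image_eqI)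
    from has_derivative_compose[OF DL this]
    have "((\<lambda>x. x) has_derivative (\<lambda>v. dirderiv (L v) \<psi> 0)) (at 0)"
      by (rule has_derivative_transform_within_open[OF _ U]) (rule \<psi>\<phi>)
    from has_derivative_unique[OF this has_derivative_ident]
    have "dirderiv (L v) \<psi> 0 = v" for v by (rule fun_cong)
    then show "inj L" by (rule inj_on_inverseI)
    then show "surj L" using linL by (simp add: linear_injective_imp_surjective)
  qed
  have d\<phi>: "(dirderiv v \<phi> has_derivative (\<lambda>u. dirderiv u (dirderiv v \<phi>) 0)) (at 0)" for v
    by (rule smooth_on_has_derivative[OF smooth_on_dirderiv[OF s\<phi>] U(2)])
  have nth: "((\<lambda>x. g x $ l) has_derivative (\<lambda>v. g' v $ l)) (at x)"
    if "(g has_derivative g') (at x)" for g :: "real^'n \<Rightarrow> real^'n" and g' l x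
    by (rule bounded_linear.has_derivative[OF bounded_linear_vec_nth that])
  \<comment> \<open>The second differential of \<open>Q\<close>, that is, twice its polar
    form.\<close>
  define B where "B x y = (\<Sum>l\<in>?K. \<Sum>m\<in>?K. q l m * (x $ l * y $ m + y $ l * x $ m))" for x y :: "real^'n"
  have hess: "dirderiv u (dirderiv v f) 0 = B (L u) (L v)" for u v
  proof -
    \<comment> \<open>The derivative of the composite in direction \<open>v\<close>. Its cubic part
      is at least quadratic in \<open>\<phi> x\<close>, so at 0, where \<open>\<phi>\<close>
      vanishes, only \<open>B\<close> survives a further differentiation.\<close>
    define E where "E x = 2 * \<phi> x $ i * dirderiv v \<phi> x $ i * \<phi> x $ j + (\<phi> x $ i)\<^sup>2 * dirderiv v \<phi> x $ j
      + 3 * e * (\<phi> x $ j)\<^sup>2 * dirderiv v \<phi> x $ j + B (\<phi> x) (dirderiv v \<phi> x)" for x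
    have dfE: "dirderiv v f x = E x" if x: "x \<in> U" for x
    proof -
      note D = nth[OF D\<phi>[OF x]]
      have "((\<lambda>k. c + (\<phi> k $ i)\<^sup>2 * \<phi> k $ j + e * (\<phi> k $ j)^3 + Q (\<phi> k)) has_derivative
        (\<lambda>v. 2 * \<phi> x $ i * dirderiv v \<phi> x $ i * \<phi> x $ j + (\<phi> x $ i)\<^sup>2 * dirderiv v \<phi> x $ j
      + 3 * e * (\<phi> x $ j)\<^sup>2 * dirderiv v \<phi> x $ j + B (\<phi> x) (dirderiv v \<phi> x))) (at x)"
        unfolding Q B_def
        by (rule derivative_eq_intros D refl)+ (simp add: fun_eq_iff algebra_simps)
      from has_derivative_transform_within_open[OF this U(1) x fU[symmetric]]
      show ?thesis unfolding E_def by (rule dirderiv_eqI)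
    qed
    note D = nth[OF DL] nth[OF d\<phi>[of v]]
    have "(E has_derivative (\<lambda>u. B (L u) (L v))) (at 0)"
      unfolding E_def[abs_def] B_def
      by (rule derivative_eq_intros D refl)+ (simp add: fun_eq_iff \<phi>0 L_def algebra_simps)
    from has_derivative_transform_within_open[OF this U dfE[symmetric]]
    show ?thesis by (rule dirderiv_eqI)
  qed
  have Lplane: "L u $ l = 0" if u: "u \<in> coordinate_plane i j" and l: "l \<in> ?K" for u l
  proof -
    \<comment> \<open>Surjectivity of \<open>L\<close> turns vanishing of the second differential of
      \<open>f\<close> against all \<open>v\<close> into membership of \<open>L u\<close> in the
      radical of \<open>B\<close>; testing against axis vectors then brings in the nondegeneracy of
      \<open>Q\<close>.\<close>
    have B0: "B (L u) w = 0" for w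
    proof -
      obtain v where "w = L v" using surjL by (metis surjD)
      then have "B (L u) w = dirderiv v (dirderiv u f) 0"
        using dirderiv_commute[OF f] by (simp add: hess)
      also have "\<dots> = 0"
        using u unfolding ker[symmetric]
        by (simp add: second_differential_kernel_def second_differential_def dirderiv_def)
      finally show ?thesis .
    qed
    have B2: "B x (axis l 1) = 2 * (\<Sum>m\<in>?K. q l m * x $ m)" if l: "l \<in> ?K" for x l
    proof -
      have "B x (axis l 1) = (\<Sum>k\<in>?K. \<Sum>m\<in>?K. (if m = l then q k l * x $ k else 0))
          + (\<Sum>k\<in>?K. \<Sum>m\<in>?K. (if k = l then q l m * x $ m else 0))"
        unfolding B_def sum.distrib[symmetric] by (intro sum.cong refl) (auto simp: axis_def)
      also have "(\<Sum>k\<in>?K. \<Sum>m\<in>?K. (if m = l then q k l * x $ k else 0)) = (\<Sum>k\<in>?K. q k l * x $ k)"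
        using l by (simp add: sum.delta)
      also have "\<dots> = (\<Sum>m\<in>?K. q l m * x $ m)"
        by (rule sum.cong) (use qsym l in auto)
      also have "(\<Sum>k\<in>?K. \<Sum>m\<in>?K. (if k = l then q l m * x $ m else 0)) = (\<Sum>m\<in>?K. q l m * x $ m)"
        by (subst sum.swap) (use l in \<open>simp add: sum.delta\<close>)
      finally show ?thesis by simp
    qed
    have "\<forall>l\<in>?K. (\<Sum>m\<in>?K. q l m * L u $ m) = 0"
    proof
      fix l assume "l \<in> ?K"
      from B2[OF this, of "L u"] show "(\<Sum>m\<in>?K. q l m * L u $ m) = 0" unfolding B0 by simp
    qed
    from qnd[OF this] show ?thesis using l by blast
  qed
  have cubics: "cubic ?k (u $ i) (u $ j) = cubic (0, 1, 0, e) (L u $ i) (L u $ j)"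
    if u: "u \<in> coordinate_plane i j" for u
  proof -
    \<comment> \<open>The limit of \<open>(f (t *\<^sub>R u) - f 0) / t^3\<close> is computed twice,
      here from the decomposition, where continuity of \<open>a\<close> produces the coefficients
      \<open>?k\<close>, and further on from the normal form.\<close>
    obtain a b1 b2 b3 q' where
      fz: "\<And>z. f z = f 0 + cubic (a z) (z $ i) (z $ j)
        + rest_part i j z \<bullet> ((z $ i)\<^sup>2 *\<^sub>R b1 z + (z $ i * z $ j) *\<^sub>R b2 z + (z $ j)\<^sup>2 *\<^sub>R b3 z)
        + rest_part i j z \<bullet> (q' z *v rest_part i j z)"
      and sa: "smooth_on UNIV a" and a0: "a 0 = ?k"
    proof (rule smooth_plane_decomposition[OF ij f crit ker, folded d_def])
    qed (rule that)
    have tu: "((\<lambda>t. t *\<^sub>R u) \<longlongrightarrow> 0) (at 0)"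
      by (rule tendsto_eq_intros refl | simp)+
    have rest0: "rest_part i j (t *\<^sub>R u) = 0" for t
      using u by (auto simp: vec_eq_iff rest_part_nth[OF ij] coordinate_plane_def)
    have fa: "f (t *\<^sub>R u) - f 0 = t^3 * cubic (a (t *\<^sub>R u)) (u $ i) (u $ j)" for t
      unfolding fz[of "t *\<^sub>R u"] rest0
      by (simp add: cubic_def case_prod_unfold power2_eq_square power3_eq_cube algebra_simps)
    have "isCont a 0"
      using smooth_on_imp_continuous_on[OF sa] by (simp add: continuous_on_eq_continuous_at)
    then have "((\<lambda>t. a (t *\<^sub>R u)) \<longlongrightarrow> a 0) (at 0)"
      using isCont_tendsto_compose[OF _ tu] by blast
    then have "((\<lambda>t. cubic (a (t *\<^sub>R u)) (u $ i) (u $ j)) \<longlongrightarrow> cubic ?k (u $ i) (u $ j)) (at 0)"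
      unfolding cubic_def case_prod_unfold a0[symmetric] by (intro tendsto_intros)
    then have lim1: "((\<lambda>t. (f (t *\<^sub>R u) - f 0) / t^3) \<longlongrightarrow> cubic ?k (u $ i) (u $ j)) (at 0)"
      by (rule Lim_transform_eventually) (auto simp: eventually_at_filter fa)
    have inU: "\<forall>\<^sub>F t in nhds (0::real). t *\<^sub>R u \<in> U"
    proof -
      have "open ((\<lambda>t::real. t *\<^sub>R u) -` U)"
        by (intro open_vimage U(1) continuous_intros)
      then show ?thesis
        using U(2) by (auto simp: eventually_nhds intro!: exI[of _ "(\<lambda>t::real. t *\<^sub>R u) -` U"])
    qed
    have along: "((\<lambda>t. g (t *\<^sub>R u) $ l) has_real_derivative dirderiv u g (t *\<^sub>R u) $ l) (at t)"
      if g: "smooth_on U g" and t: "t *\<^sub>R u \<in> U" for g :: "real^'n \<Rightarrow> real^'n" and l t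
    proof -
      have Dg: "(g has_derivative (\<lambda>v. dirderiv v g (t *\<^sub>R u))) (at (t *\<^sub>R u))"
        by (rule smooth_on_has_derivative[OF g t])
      have "((\<lambda>t. g (t *\<^sub>R u)) has_derivative (\<lambda>s. dirderiv (s *\<^sub>R u) g (t *\<^sub>R u))) (at t)"
        by (rule has_derivative_compose[where f="\<lambda>t. t *\<^sub>R u", OF _ Dg]) (auto intro!: derivative_eq_intros)
      from bounded_linear.has_derivative[OF bounded_linear_vec_nth this, of l]
      have "((\<lambda>t. g (t *\<^sub>R u) $ l) has_derivative (\<lambda>s. dirderiv (s *\<^sub>R u) g (t *\<^sub>R u) $ l)) (at t)" .
      moreover have "dirderiv (s *\<^sub>R u) g (t *\<^sub>R u) = s *\<^sub>R dirderiv u g (t *\<^sub>R u)" for s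
        using linear_scale[OF has_derivative_linear[OF Dg]] by simp
      ultimately show ?thesis
        by (simp add: has_field_derivative_def mult.commute[of _ "_ $ l"] cong: if_cong)
    qed
    have lin: "((\<lambda>t. \<phi> (t *\<^sub>R u) $ l / t) \<longlongrightarrow> L u $ l) (at 0)" for l
      using along[OF s\<phi>, where t=0 and l=l] U(2) by (simp add: DERIV_def \<phi>0 L_def)
    define M where "M l = dirderiv u (dirderiv u \<phi>) 0 $ l / 2" for l
    have quad: "((\<lambda>t. \<phi> (t *\<^sub>R u) $ l / t\<^sup>2) \<longlongrightarrow> M l) (at 0)" if l: "l \<in> ?K" for l
      unfolding M_def
    proof (rule tendsto_over_square[where h'="\<lambda>t. dirderiv u \<phi> (t *\<^sub>R u) $ l"])
      show "\<forall>\<^sub>F t in nhds 0. ((\<lambda>t. \<phi> (t *\<^sub>R u) $ l) has_real_derivative dirderiv u \<phi> (t *\<^sub>R u) $ l) (at t)"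
        using inU by eventually_elim (rule along[OF s\<phi>])
      show "((\<lambda>t. dirderiv u \<phi> (t *\<^sub>R u) $ l) has_real_derivative dirderiv u (dirderiv u \<phi>) 0 $ l) (at 0)"
        using along[OF smooth_on_dirderiv[OF s\<phi>], where t=0 and l=l] U(2) by simp
    qed (use Lplane[OF u l] in \<open>simp_all add: \<phi>0 L_def\<close>)
    \<comment> \<open>\<open>Q\<close> is quadratic in components of order two in \<open>t\<close>,
      so it is of order four and retains a factor \<open>t\<close> after division by
      \<open>t^3\<close>.\<close>
    have "((\<lambda>t. (\<phi> (t *\<^sub>R u) $ i / t)\<^sup>2 * (\<phi> (t *\<^sub>R u) $ j / t) + e * (\<phi> (t *\<^sub>R u) $ j / t)^3
        + t * (\<Sum>l\<in>?K. \<Sum>m\<in>?K. q l m * (\<phi> (t *\<^sub>R u) $ l / t\<^sup>2) * (\<phi> (t *\<^sub>R u) $ m / t\<^sup>2)))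
      \<longlongrightarrow> (L u $ i)\<^sup>2 * L u $ j + e * (L u $ j)^3 + 0 * (\<Sum>l\<in>?K. \<Sum>m\<in>?K. q l m * M l * M m)) (at 0)"
      by (intro tendsto_intros lin quad) auto
    then have "((\<lambda>t. (f (t *\<^sub>R u) - f 0) / t^3) \<longlongrightarrow> (L u $ i)\<^sup>2 * L u $ j + e * (L u $ j)^3 + 0 * (\<Sum>l\<in>?K. \<Sum>m\<in>?K. q l m * M l * M m)) (at 0)"
    proof (rule Lim_transform_eventually)
      have c: "f 0 = c" using fU[OF U(2)] by (simp add: \<phi>0 Q)
      have "(\<phi> (t *\<^sub>R u) $ i / t)\<^sup>2 * (\<phi> (t *\<^sub>R u) $ j / t) + e * (\<phi> (t *\<^sub>R u) $ j / t)^3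
        + t * (\<Sum>l\<in>?K. \<Sum>m\<in>?K. q l m * (\<phi> (t *\<^sub>R u) $ l / t\<^sup>2) * (\<phi> (t *\<^sub>R u) $ m / t\<^sup>2))
        = (f (t *\<^sub>R u) - f 0) / t^3" if t: "t *\<^sub>R u \<in> U" "t \<noteq> 0" for t
      proof -
        have "t * (\<Sum>l\<in>?K. \<Sum>m\<in>?K. q l m * (\<phi> (t *\<^sub>R u) $ l / t\<^sup>2) * (\<phi> (t *\<^sub>R u) $ m / t\<^sup>2)) = Q (\<phi> (t *\<^sub>R u)) / t^3"
          unfolding Q sum_distrib_left sum_divide_distrib
          using t(2) by (intro sum.cong refl) (simp add: power2_eq_square power3_eq_cube)
        then show ?thesis
          unfolding fU[OF t(1)] c using t(2)
          by (simp add: power2_eq_square power3_eq_cube add_divide_distrib)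
      qed
      then show "\<forall>\<^sub>F t in at 0. (\<phi> (t *\<^sub>R u) $ i / t)\<^sup>2 * (\<phi> (t *\<^sub>R u) $ j / t) + e * (\<phi> (t *\<^sub>R u) $ j / t)^3
        + t * (\<Sum>l\<in>?K. \<Sum>m\<in>?K. q l m * (\<phi> (t *\<^sub>R u) $ l / t\<^sup>2) * (\<phi> (t *\<^sub>R u) $ m / t\<^sup>2))
        = (f (t *\<^sub>R u) - f 0) / t^3"
        using inU unfolding eventually_at_filter by (auto elim: eventually_mono)
    qed
    from tendsto_unique[OF _ lim1 this] show ?thesis by (simp add: cubic_def)
  qed
  define m1 m2 m3 m4 where "m1 = L (axis i 1) $ i" and "m2 = L (axis j 1) $ i"
    and "m3 = L (axis i 1) $ j" and "m4 = L (axis j 1) $ j"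
  let ?u = "\<lambda>x y. x *\<^sub>R axis i 1 + y *\<^sub>R axis j 1 :: real^'n"
  have Lu: "L (?u x y) $ i = m1 * x + m2 * y" "L (?u x y) $ j = m3 * x + m4 * y" for x y
    by (simp_all add: linear_add[OF linL] linear_scale[OF linL] m1_def m2_def m3_def m4_def mult.commute)
  have u: "?u x y \<in> coordinate_plane i j" "?u x y $ i = x" "?u x y $ j = y" for x y
    using ij by (auto simp: coordinate_plane_def axis_def)
  have k: "?k = cubic_subst (m1, m2, m3, m4) (0, 1, 0, e)"
  proof (rule cubic_eqD)
    show "cubic ?k x y = cubic (cubic_subst (m1, m2, m3, m4) (0, 1, 0, e)) x y" for x y
      using cubics[OF u(1), of x y] unfolding cubic_cubic_subst Lu u .
  qed
  \<comment> \<open>\<open>L\<close> is injective and maps the plane into itself, so its restriction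
    to the plane is invertible.\<close>
  have "m1 * m4 - m2 * m3 \<noteq> 0"
  proof
    assume "m1 * m4 - m2 * m3 = 0"
    then obtain x y where xy: "x \<noteq> 0 \<or> y \<noteq> 0" "m1 * x + m2 * y = 0" "m3 * x + m4 * y = 0"
      using singular_2x2_kernel by blast
    have "L (?u x y) $ l = 0" for l
      using Lplane[OF u(1), of l x y] Lu[of x y] xy by (cases "l \<in> {i, j}") auto
    then have "L (?u x y) = L 0"
      by (simp add: vec_eq_iff linear_0[OF linL])
    then have "?u x y = 0" using injL by (simp add: inj_eq)
    then show False using u(2,3)[of x y] xy(1) by simp
  qed
  \<comment> \<open>The discriminant of the normal form \<open>(0, 1, 0, e)\<close> is
    \<open>4 * e\<close>.\<close>
  then show ?thesis
    unfolding k cubic_disc_cubic_subst using e by (simp add: cubic_disc_def)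
qed

section \<open>Translation to partial derivatives and conclusion\<close>

lemma partial_deriv_eq_dirderiv:
  fixes f :: "real^'n::finite \<Rightarrow> real"
  assumes "smooth_on UNIV f"
  shows "partial_deriv l f = dirderiv (axis l 1) f"
proof
  fix x
  show "partial_deriv l f x = dirderiv (axis l 1) f x"
    using has_vector_derivative_along_line[OF assms, of x "axis l 1" 0]
    by (simp add: partial_deriv_def DERIV_imp_deriv has_real_derivative_iff_has_vector_derivative)
qed

theorem mainTheorem4:
  fixes f :: "real^'n::finite \<Rightarrow> real" and i j :: 'n
    and A B C D \<Delta> :: real
  assumes "i \<noteq> j"
    and "smooth_on UNIV f"
    and "critical_point f 0"
    and "second_differential_kernel f 0 = coordinate_plane i j"
    and "A = partial_deriv i (partial_deriv i (partial_deriv i f)) 0 / fact 3"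
    and "B = partial_deriv i (partial_deriv i (partial_deriv j f)) 0 / fact 2"
    and "C = partial_deriv i (partial_deriv j (partial_deriv j f)) 0 / fact 2"
    and "D = partial_deriv j (partial_deriv j (partial_deriv j f)) 0 / fact 3"
    and "\<Delta> = 4 * (B^3 * D + A * C^3) + 27 * A\<^sup>2 * D\<^sup>2 - B\<^sup>2 * C\<^sup>2 - 18 * A * B * C * D"
  shows "(D4 i j f \<longleftrightarrow> \<Delta> \<noteq> 0) \<and>
    (\<Delta> \<noteq> 0 \<longrightarrow>
      (\<exists>d Q. nondegenerate_quadratic_form (UNIV - {i, j}) Q \<and>
        reduces_near_0 f (\<lambda>x. d + (x $ i)\<^sup>2 * x $ j + \<Delta> * (x $ j)^3 + Q x))) \<and>
    (\<Delta> > 0 \<longrightarrow> D4_plus i j f) \<and>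
    (\<Delta> < 0 \<longrightarrow> D4_minus i j f)"
proof -
  define d where "d u v w = dirderiv (axis u 1) (dirderiv (axis v 1) (dirderiv (axis w 1) f)) 0" for u v w
  note f = assms(2)
  have partials: "partial_deriv u (partial_deriv v (partial_deriv w f)) 0 = d u v w" for u v w
    by (simp add: d_def partial_deriv_eq_dirderiv smooth_on_dirderiv f)
  have ABCD: "A = d i i i / 6" "B = d i i j / 2" "C = d i j j / 2" "D = d j j j / 6"
    using assms(5-8) by (simp_all add: partials fact_numeral)
  have \<Delta>: "\<Delta> = cubic_disc (d i i i / 6, d i i j / 2, d i j j / 2, d j j j / 6)"
    unfolding assms(9) ABCD cubic_disc_def by simp
  \<comment> \<open>Only the sign of \<open>e\<close> is constrained: 1 and -1 yield the two types,
    and \<open>e = \<Delta>\<close> is admissible because its square is positive.\<close>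
  have reduction: "\<exists>Q. nondegenerate_quadratic_form (UNIV - {i, j}) Q \<and>
      reduces_near_0 f (\<lambda>x. f 0 + (x $ i)\<^sup>2 * x $ j + e * (x $ j)^3 + Q x)" if "e * \<Delta> > 0" for e
    using smooth_reduction_to_normal_form[OF assms(1-4), of e] that unfolding \<Delta> d_def by blast
  have nonzero: "\<Delta> \<noteq> 0" if "e \<noteq> 0" "nondegenerate_quadratic_form (UNIV - {i, j}) Q"
    "reduces_near_0 f (\<lambda>x. c + (x $ i)\<^sup>2 * x $ j + e * (x $ j)^3 + Q x)" for e c Q
    using cubic_disc_nonzero_of_reduction[OF assms(1-4) that] unfolding \<Delta> d_def .
  have plus: "D4_plus i j f" if "\<Delta> > 0"
    using reduction[of 1] that unfolding D4_plus_def by auto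
  have minus: "D4_minus i j f" if "\<Delta> < 0"
    using reduction[of "-1"] that unfolding D4_minus_def by auto
  have "\<Delta> \<noteq> 0" if "D4 i j f"
    using that nonzero[of 1] nonzero[of "-1"] unfolding D4_def D4_plus_def D4_minus_def by auto
  moreover have "\<exists>c Q. nondegenerate_quadratic_form (UNIV - {i, j}) Q \<and>
      reduces_near_0 f (\<lambda>x. c + (x $ i)\<^sup>2 * x $ j + \<Delta> * (x $ j)^3 + Q x)" if "\<Delta> \<noteq> 0"
  proof -
    have "\<Delta> * \<Delta> > 0" using that by (simp add: zero_less_mult_iff neq_iff disj_commute)
    then show ?thesis using reduction by blast
  qed
  ultimately show ?thesis
    using plus minus unfolding D4_def by (meson linorder_neqE_linordered_idom)
qed

end
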